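(* Let $n,r,s$ be integers with $n\geq 2r+1$, $r\geq 0$ and $s\geq 1$. Let $L_1,\ldots,L_s\subset\mathbb{P}^n$ be pairwise disjoint linear subspaces of dimension $r$, and let $I=I(L_1)\cap\cdots\cap I(L_s)$ be the ideal of their union. Then the polynomial $\Lambda_{n,r,s}(\tau)$ has exactly one real root bigger than or equal to $1$ (i.e. there is exactly one real number $\tau\geq 1$ with $\Lambda_{n,r,s}(\tau)=0$). Moreover, if this largest real root is denoted by $g_{n,r,s}$, then $$\gamma(I)\leq e_{n,r,s}\leq g_{n,r,s}.$$
   Context: $k$ is an algebraically closed field, $\mathbb{P}^n=\mathbb{P}^n_k$ and $k[\mathbb{P}^n]=k[x_0,\ldots,x_n]$ with the standard grading; $I(L)$ is the ideal generated by all forms vanishing on $L$. For a nonzero homogeneous ideal $J\subset k[\mathbb{P}^n]$, $\alpha(J)$ is the least degree of a nonzero form in $J$, and the Waldschmidt constant is $\gamma(J)=\lim_{m\to\infty}\alpha(J^{(m)})/m=\inf_{m\ge 1}\alpha(J^{(m)})/m$, where $J^{(m)}$ is the $m$th symbolic power. For $I=I(L_1)\cap\cdots\cap I(L_s)$ as in the claim, $I^{(m)}=I(L_1)^m\cap\cdots\cap I(L_s)^m$. For a positive integer $m$ let $$c_{n,r,m,t}=\sum_{0\leq i<m}\binom{t-i+r}{r}\binom{i+n-r-1}{n-r-1},$$ regarded as a polynomial in $t$ (with $\binom{x+a}{a}=\frac{(x+a)\cdots(x+1)}{a!}$), and let $P_{n,r,s,m}(t)=\binom{t+n}{n}-s\,c_{n,r,m,t}$,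 a polynomial in $t$ of degree $n$. Substituting $t=m\tau$, the expression $P_{n,r,s,m}(m\tau)$ is a polynomial in $m$ of degree $n$ with coefficients in $\mathbb{Q}[\tau]$; $\Lambda_{n,r,s}(\tau)\in\mathbb{Q}[\tau]$ denotes the coefficient of $m^n$ in it. The expected Waldschmidt constant is $$e_{n,r,s}=\inf\left\{\tfrac{t}{m}:\ t,m\in\mathbb{Z},\ t\geq m\geq 1,\ P_{n,r,s,m}(t)>0\right\}.$$ *)

theory Defs
  imports
    "HOL-Analysis.Analysis"
    "HOL-Computational_Algebra.Polynomial"
    "HOL-Library.Poly_Mapping"
begin

section \<open>Forms and ideals in a polynomial ring\<close>

text \<open>
  Polynomials over \<open>'k\<close> in variables indexed by the finite type \<open>'n\<close>: finitely supported
  maps from exponent vectors to coefficients, with the convolution product of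
  \<^theory>\<open>HOL-Library.Poly_Mapping\<close>. The homogeneous coordinate ring of the \<open>n\<close>-dimensional
  projective space is the case \<open>CARD('n) = n + 1\<close>.
\<close>

type_synonym ('n, 'k) mpoly = "('n \<Rightarrow>\<^sub>0 nat) \<Rightarrow>\<^sub>0 'k"

definition eval_mpoly :: "('n::finite, 'k::comm_ring_1) mpoly \<Rightarrow> 'k ^ 'n \<Rightarrow> 'k" where
  "eval_mpoly f x =
     (\<Sum>u\<in>Poly_Mapping.keys f. Poly_Mapping.lookup f u * (\<Prod>i\<in>UNIV. (x $ i) ^ Poly_Mapping.lookup u i))"

text \<open>The zero polynomial is a form of every degree.\<close>

definition form :: "nat \<Rightarrow> ('n::finite, 'k::comm_ring_1) mpoly \<Rightarrow> bool" where
  "form d f \<longleftrightarrow> (\<forall>u\<in>Poly_Mapping.keys f. (\<Sum>i\<in>UNIV. Poly_Mapping.lookup u i) = d)"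

text \<open>Ideals of a commutative ring are its submodules as a module over itself.\<close>

definition ideal_generated :: "'a::comm_ring_1 set \<Rightarrow> 'a set" where
  "ideal_generated S = module.span (*) S"

definition prime_ideal :: "'a::comm_ring_1 set \<Rightarrow> bool" where
  "prime_ideal P \<longleftrightarrow>
     module.subspace (*) P \<and> P \<noteq> UNIV \<and> (\<forall>a b. a * b \<in> P \<longrightarrow> a \<in> P \<or> b \<in> P)"

primrec ideal_power :: "'a::comm_ring_1 set \<Rightarrow> nat \<Rightarrow> 'a set" where
  "ideal_power J 0 = UNIV"
| "ideal_power J (Suc m) = ideal_generated {a * b |a b. a \<in> J \<and> b \<in> ideal_power J m}"

text \<open>The associated primes of \<open>R / J\<close>: the prime ideals of the form \<open>(J : f)\<close>.\<close>

definition associated_primes :: "'a::comm_ring_1 set \<Rightarrow> 'a set set" where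
  "associated_primes J = {P. prime_ideal P \<and> (\<exists>f. P = {g. g * f \<in> J})}"

text \<open>
  The symbolic power \<open>J\<^sup>(\<^sup>m\<^sup>)\<close> is the intersection over the associated primes \<open>P\<close> of \<open>J\<close>
  of the contractions \<open>J\<^sup>m R\<^sub>P \<inter> R\<close>. An element \<open>f\<close> lies in the contraction at \<open>P\<close> iff
  \<open>g f \<in> J\<^sup>m\<close> for some \<open>g\<close> outside \<open>P\<close>. For the ideal of a union of pairwise disjoint linear
  subspaces \<open>L\<^sub>1, \<dots>, L\<^sub>s\<close> this is \<open>I(L\<^sub>1)\<^sup>m \<inter> \<dots> \<inter> I(L\<^sub>s)\<^sup>m\<close>.
\<close>

definition symbolic_power :: "'a::comm_ring_1 set \<Rightarrow> nat \<Rightarrow> 'a set" where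
  "symbolic_power J m =
     {f. \<forall>P\<in>associated_primes J. \<exists>g. g \<notin> P \<and> g * f \<in> ideal_power J m}"

definition initial_degree :: "('n::finite, 'k::comm_ring_1) mpoly set \<Rightarrow> nat" where
  "initial_degree J = (LEAST d. \<exists>f\<in>J. f \<noteq> 0 \<and> form d f)"

definition waldschmidt_constant :: "('n::finite, 'k::comm_ring_1) mpoly set \<Rightarrow> real" where
  "waldschmidt_constant J = lim (\<lambda>m. real (initial_degree (symbolic_power J m)) / real m)"

section \<open>Linear subspaces of projective space\<close>

text \<open>Points of projective space are the one-dimensional subspaces of \<^typ>\<open>'k ^ 'n\<close>.\<close>

definition projective_points :: "('k::field ^ 'n::finite) set set" where
  "projective_points = {p. vec.subspace p \<and> vec.dim p = 1}"

definition projective_linear_subspace :: "nat \<Rightarrow> ('k::field ^ 'n::finite) set set \<Rightarrow> bool" where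
  "projective_linear_subspace r L \<longleftrightarrow>
     (\<exists>V. vec.subspace V \<and> vec.dim V = r + 1 \<and> L = {p \<in> projective_points. p \<subseteq> V})"

definition vanishing_ideal :: "('k::field ^ 'n::finite) set set \<Rightarrow> ('n, 'k) mpoly set" where
  "vanishing_ideal L =
     ideal_generated {f. (\<exists>d. form d f) \<and> (\<forall>p\<in>L. \<forall>x\<in>p - {0}. eval_mpoly f x = 0)}"

section \<open>The expected Waldschmidt constant\<close>

text \<open>The binomial coefficient \<open>x + a\<close> over \<open>a\<close> as a polynomial in \<open>x\<close>.\<close>

definition binomial_poly :: "nat \<Rightarrow> rat poly" where
  "binomial_poly a = smult (1 / fact a) (\<Prod>j=1..a. [:of_nat j, 1:])"

definition conditions_poly :: "nat \<Rightarrow> nat \<Rightarrow> nat \<Rightarrow> rat poly" where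
  "conditions_poly n r m =
     (\<Sum>i<m. smult (of_nat ((i + (n - r - 1)) choose (n - r - 1)))
               (pcompose (binomial_poly r) [:- of_nat i, 1:]))"

definition expected_poly :: "nat \<Rightarrow> nat \<Rightarrow> nat \<Rightarrow> nat \<Rightarrow> rat poly" where
  "expected_poly n r s m = binomial_poly n - smult (of_nat s) (conditions_poly n r m)"

text \<open>
  \<open>expected_poly n r s m\<close> evaluated at \<open>m \<tau>\<close>, as a polynomial in \<open>m\<close> with coefficients in
  \<open>\<rat>[\<tau>]\<close>: the outer variable of the nested polynomial type is \<open>m\<close>, the inner one \<open>\<tau>\<close>.
  It is determined by its values at all positive integers \<open>m\<close>.
\<close>

definition expected_poly_homog :: "nat \<Rightarrow> nat \<Rightarrow> nat \<Rightarrow> rat poly poly" where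
  "expected_poly_homog n r s =
     (THE Q. \<forall>m\<ge>1. poly Q (of_nat m) = pcompose (expected_poly n r s m) [:0, of_nat m:])"

definition Lambda_poly :: "nat \<Rightarrow> nat \<Rightarrow> nat \<Rightarrow> rat poly" where
  "Lambda_poly n r s = coeff (expected_poly_homog n r s) n"

definition Lambda_roots :: "nat \<Rightarrow> nat \<Rightarrow> nat \<Rightarrow> real set" where
  "Lambda_roots n r s = {\<tau>. poly (map_poly of_rat (Lambda_poly n r s)) \<tau> = 0}"

definition expected_waldschmidt :: "nat \<Rightarrow> nat \<Rightarrow> nat \<Rightarrow> real" where
  "expected_waldschmidt n r s =
     Inf {real t / real m |t m. t \<ge> m \<and> m \<ge> 1 \<and> poly (expected_poly n r s m) (of_nat t) > 0}"

end

theory Submission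
  imports Defs
begin

text \<open>
  The bound \<open>\<gamma>(I) \<le> e\<close> is a dimension count. A form of degree \<open>t\<close> has
  \<open>t + n\<close> over \<open>n\<close> coefficients. In linear coordinates adapted to \<open>L\<^sub>i\<close> it lies in
  \<open>I(L\<^sub>i)\<^sup>m\<close> as soon as the coefficients at monomials of degree less than \<open>m\<close> in the
  \<open>n - r\<close> transversal variables are zero, and for \<open>t \<ge> m\<close> there are exactly
  \<open>c\<^sub>n\<^sub>,\<^sub>r\<^sub>,\<^sub>m\<^sub>,\<^sub>t\<close> of these. Hence \<open>P\<^sub>n\<^sub>,\<^sub>r\<^sub>,\<^sub>s\<^sub>,\<^sub>m(t) > 0\<close> produces a nonzero form of
  degree \<open>t\<close> in every \<open>I(L\<^sub>i)\<^sup>m\<close> (\<open>exists_form_in_ideal_powers\<close>). Over an infinite field the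
  ideals \<open>I(L\<^sub>i)\<close> are the prime ideals of all polynomials that vanish on the underlying vector
  spaces; since the \<open>L\<^sub>i\<close> are disjoint, none contains another, they account for all associated
  primes of \<open>I\<close>, and the form lies in the \<open>m\<close>th symbolic power
  (\<open>symbolic_power_Inter_primes\<close>). The initial degrees of the symbolic powers are subadditive, so
  by Fekete's lemma the limit that defines \<open>\<gamma>(I)\<close> is at most \<open>t / m\<close>
  (\<open>waldschmidt_constant_le\<close>).

  The polynomial \<open>\<Lambda>\<close> becomes tractable through the identity
  \<open>c\<^sub>n\<^sub>,\<^sub>r\<^sub>,\<^sub>m\<^sub>,\<^sub>t = \<Sum>j\<le>r. (t - m + r + 1 choose j) (m + n - r - 1 choose n - j)\<close>
  (\<open>poly_conditions_poly\<close>). It gives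
  \<open>n! \<Lambda>(\<tau>) = \<tau>\<^sup>n - s (\<Sum>j\<le>r. (n choose j) (\<tau> - 1)\<^sup>j) = \<tau>\<^sup>n (1 - s F(1 / \<tau>))\<close>, where \<open>F(u)\<close> is
  the probability that at most \<open>r\<close> of \<open>n\<close> independent events of probability \<open>1 - u\<close> occur.
  This \<open>F\<close> increases strictly from \<open>F(0) = 0\<close> to \<open>F(1) = 1\<close>, since its derivative is a positive
  multiple of \<open>(1 - u)\<^sup>r u\<^sup>n\<^sup>-\<^sup>r\<^sup>-\<^sup>1\<close>, and so takes the value \<open>1 / s\<close> exactly once
  (\<open>Lambda_unique_root\<close>).

  Beyond the root \<open>g\<close> the polynomial \<open>\<Lambda>\<close> is positive. For a rational number \<open>a / b > g\<close> the
  value \<open>P\<^sub>n\<^sub>,\<^sub>r\<^sub>,\<^sub>s\<^sub>,\<^sub>k\<^sub>b(k a)\<close> is asymptotic to \<open>(k b)\<^sup>n \<Lambda>(a / b)\<close>, hence positive for large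
  \<open>k\<close>, and \<open>e \<le> a / b\<close>. As \<open>a / b\<close> tends to \<open>g\<close> this gives \<open>e \<le> g\<close>
  (\<open>expected_waldschmidt_le_root\<close>).
\<close>

section \<open>The expected polynomial in closed form\<close>

lemma poly_binomial_poly: "poly (binomial_poly a) x = (x + of_nat a) gchoose a"
proof -
  have "(\<Prod>j=1..a. of_nat j + x) = (\<Prod>i\<in>{0..<a}. x + 1 + of_nat i)"
    by (rule prod.reindex_bij_witness[of _ Suc "\<lambda>j. j - 1"]) (auto simp: algebra_simps)
  then show ?thesis
    by (simp add: binomial_poly_def poly_prod gbinomial_pochhammer' pochhammer_prod algebra_simps)
qed

text \<open>
  Pascal's rule, applied to \<open>Suc N choose (n - j)\<close> on the left and to \<open>y + 1 gchoose j\<close>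
  on the right, produces the same products up to a shift of \<open>j\<close>, so the difference of the two sums
  telescopes and only the product at the upper end survives.
\<close>

lemma vandermonde_telescope:
  fixes y :: "'a::field_char_0"
  assumes "r < n"
  shows "(\<Sum>j\<le>r. (y gchoose j) * of_nat (Suc N choose (n - j)))
       = (\<Sum>j\<le>r. (y + 1 gchoose j) * of_nat (N choose (n - j)))
         + (y gchoose r) * of_nat (N choose (n - r - 1))"
  using assms
proof (induction r)
  case 0
  then obtain d where "n = Suc d" by (cases n) auto
  then show ?case by simp
next
  case (Suc r)
  then obtain d where d: "n = Suc (Suc (r + d))"
    using less_imp_Suc_add by blast
  have "n - r = Suc (Suc d)" "n - Suc r = Suc d" using d by auto
  with Suc show ?case
    by (simp add: gbinomial_Suc_Suc ring_distribs add.commute[of 1])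
qed

text \<open>
  The sum over \<open>i < m\<close> becomes a sum of \<open>r + 1\<close> products of two binomial coefficients,
  one in \<open>x - m\<close> and one in \<open>m\<close>. In this form \<open>m\<close> no longer bounds the summation, which is
  what makes the substitution \<open>x = m \<tau>\<close> polynomial in \<open>m\<close>. For integers the identity counts
  \<open>n\<close>-subsets \<open>S\<close> of \<open>{1..x + n}\<close>, read as bars that separate \<open>x\<close> stars: fewer than \<open>m\<close> stars
  precede the bar number \<open>n - r\<close> iff at most \<open>r\<close> elements of \<open>S\<close> lie among the last
  \<open>x - m + r + 1\<close> positions.
\<close>

lemma poly_conditions_poly:
  assumes "r < n"
  shows "poly (conditions_poly n r m) x =
    (\<Sum>j\<le>r. (x - of_nat m + of_nat (r + 1) gchoose j) * of_nat ((m + (n - r - 1)) choose (n - j)))"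
proof (induction m)
  case 0
  have "(0 + (n - r - 1)) choose (n - j) = 0" if "j \<le> r" for j
    using that assms by (intro binomial_eq_0) auto
  then show ?case by (simp add: conditions_poly_def del: binomial_eq_0_iff)
next
  case (Suc m)
  let ?y = "x - of_nat m + of_nat r"
  have y: "x - of_nat m + of_nat (r + 1) = ?y + 1" "x - of_nat (Suc m) + of_nat (r + 1) = ?y"
    and N: "Suc m + (n - r - 1) = Suc (m + (n - r - 1))"
    by simp_all
  have "poly (conditions_poly n r (Suc m)) x = poly (conditions_poly n r m) x
     + (?y gchoose r) * of_nat ((m + (n - r - 1)) choose (n - r - 1))"
    by (simp add: conditions_poly_def poly_pcompose poly_binomial_poly mult.commute add.commute)
  then show ?case
    unfolding Suc y N vandermonde_telescope[OF assms] by simp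
qed

lemma of_nat_add_choose:
  "of_nat ((m + k) choose j) = (of_nat m + of_nat k gchoose j :: 'a::field_char_0)"
  using binomial_gbinomial[of "m + k" j, where 'a = 'a] unfolding of_nat_add .

lemma poly_expected_poly:
  assumes "r < n"
  shows "poly (expected_poly n r s m) x = (x + of_nat n gchoose n) - of_nat s *
    (\<Sum>j\<le>r. (x - of_nat m + of_nat (r + 1) gchoose j) * (of_nat m + of_nat (n - r - 1) gchoose (n - j)))"
  unfolding expected_poly_def poly_diff poly_smult poly_binomial_poly poly_conditions_poly[OF assms]
    of_nat_add_choose by (rule refl)

section \<open>The leading coefficient Lambda\<close>

text \<open>
  The binomial coefficient \<open>m b(\<tau>) + c\<close> over \<open>k\<close>, as a polynomial in \<open>m\<close> over \<open>\<rat>[\<tau>]\<close>.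
\<close>

definition shifted_binomial :: "rat poly \<Rightarrow> nat \<Rightarrow> nat \<Rightarrow> rat poly poly" where
  "shifted_binomial b c k = smult [:1 / fact k:] (\<Prod>i<k. [:[:of_nat c - of_nat i:], b:])"

lemma poly_shifted_binomial:
  "poly (poly (shifted_binomial b c k) (of_nat m)) x = (of_nat m * poly b x + of_nat c) gchoose k"
proof -
  have "poly (of_nat m) x = of_nat m" by (simp add: of_nat_poly)
  then show ?thesis
    by (simp add: shifted_binomial_def poly_prod gbinomial_prod_rev lessThan_atLeast0 algebra_simps)
qed

lemma prod_linear_coeff:
  fixes a b :: "nat \<Rightarrow> 'a::comm_ring_1"
  shows "degree (\<Prod>i<k. [:a i, b i:]) \<le> k \<and> coeff (\<Prod>i<k. [:a i, b i:]) k = (\<Prod>i<k. b i)"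
proof (induction k)
  case (Suc k)
  let ?p = "\<Prod>i<k. [:a i, b i:]"
  have "?p * [:a k, b k:] = smult (a k) ?p + pCons 0 (smult (b k) ?p)"
    by (simp add: mult.commute[of ?p])
  moreover have "coeff ?p (Suc k) = 0" using Suc by (intro coeff_eq_0) auto
  moreover have "degree (?p * [:a k, b k:]) \<le> k + 1"
    using Suc degree_mult_le[of ?p "[:a k, b k:]"] by (simp split: if_splits)
  ultimately show ?case using Suc by (simp add: mult.commute)
qed simp

lemma degree_shifted_binomial: "degree (shifted_binomial b c k) \<le> k"
  unfolding shifted_binomial_def
  by (rule order_trans[OF degree_smult_le conjunct1[OF prod_linear_coeff]])

lemma coeff_shifted_binomial: "coeff (shifted_binomial b c k) k = smult (1 / fact k) (b ^ k)"
  using prod_linear_coeff[where a = "\<lambda>i. [:of_nat c - of_nat i:]" and b = "\<lambda>_. b" and k = k]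
  by (simp add: shifted_binomial_def)

lemma coeff_mult_top:
  fixes p q :: "'a::comm_semiring_0 poly"
  assumes "degree p \<le> a" "degree q \<le> b"
  shows "coeff (p * q) (a + b) = coeff p a * coeff q b"
proof -
  have "coeff p i * coeff q (a + b - i) = 0" if "i \<le> a + b" "i \<noteq> a" for i
  proof (cases "i < a")
    case True
    then have "coeff q (a + b - i) = 0" using assms by (intro coeff_eq_0) auto
    then show ?thesis by simp
  next
    case False
    then have "coeff p i = 0" using assms that by (intro coeff_eq_0) auto
    then show ?thesis by simp
  qed
  then have "coeff (p * q) (a + b) = (\<Sum>i\<in>{a}. coeff p i * coeff q (a + b - i))"
    unfolding coeff_mult by (intro sum.mono_neutral_right) auto
  then show ?thesis by simp
qed

definition expected_homog_witness :: "nat \<Rightarrow> nat \<Rightarrow> nat \<Rightarrow> rat poly poly" where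
  "expected_homog_witness n r s = shifted_binomial [:0, 1:] n n - of_nat s *
     (\<Sum>j\<le>r. shifted_binomial [:-1, 1:] (r + 1) j * shifted_binomial 1 (n - r - 1) (n - j))"

lemma poly_expected_homog_witness:
  assumes "r < n"
  shows "poly (expected_homog_witness n r s) (of_nat m) =
    pcompose (expected_poly n r s m) [:0, of_nat m:]"
proof (rule poly_ext)
  fix x :: rat
  have "poly (of_nat s) x = of_nat s" "poly (of_nat s :: rat poly poly) p = of_nat s" for p
    by (simp_all add: of_nat_poly)
  then show "poly (poly (expected_homog_witness n r s) (of_nat m)) x =
       poly (pcompose (expected_poly n r s m) [:0, of_nat m:]) x"
    by (simp add: expected_homog_witness_def poly_pcompose poly_expected_poly[OF assms]
        poly_sum poly_shifted_binomial algebra_simps)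
qed

text \<open>
  Two polynomials in \<open>m\<close> over the domain \<open>\<rat>[\<tau>]\<close> that agree at all positive integers have a
  difference with infinitely many roots, so the witness is the only candidate.
\<close>

lemma expected_poly_homog_eq:
  assumes "r < n"
  shows "expected_poly_homog n r s = expected_homog_witness n r s"
  unfolding expected_poly_homog_def
proof (rule the_equality)
  show "\<forall>m\<ge>1. poly (expected_homog_witness n r s) (of_nat m) =
      pcompose (expected_poly n r s m) [:0, of_nat m:]"
    using poly_expected_homog_witness[OF assms] by blast
next
  fix Q
  assume Q: "\<forall>m\<ge>1. poly Q (of_nat m) = pcompose (expected_poly n r s m) [:0, of_nat m:]"
  let ?D = "Q - expected_homog_witness n r s"
  have "of_nat ` {1..} \<subseteq> {x. poly ?D x = 0}"
    using Q poly_expected_homog_witness[OF assms] by auto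
  moreover have "infinite (of_nat ` {1::nat..} :: rat poly set)"
    by (subst finite_image_iff) (auto simp: inj_on_def infinite_Ici)
  ultimately have "infinite {x. poly ?D x = 0}" using finite_subset by blast
  then have "?D = 0" using poly_roots_finite by blast
  then show "Q = expected_homog_witness n r s" by simp
qed

text \<open>
  Every product in the witness has total degree \<open>n\<close> in \<open>m\<close>, because \<open>j + (n - j) = n\<close>; its
  coefficient of \<open>m\<^sup>n\<close> is therefore the product of the leading coefficients.
\<close>

lemma Lambda_poly_eq:
  assumes "r < n"
  shows "Lambda_poly n r s = smult (1 / fact n) ([:0, 1:] ^ n) - of_nat s *
    (\<Sum>j\<le>r. smult (1 / (fact j * fact (n - j))) ([:-1, 1:] ^ j))"
proof -
  have top: "coeff (shifted_binomial [:-1, 1:] (r + 1) j * shifted_binomial 1 (n - r - 1) (n - j)) n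
      = smult (1 / (fact j * fact (n - j))) ([:-1, 1:] ^ j)" if "j \<le> r" for j
  proof -
    have "j + (n - j) = n" using that assms by simp
    then have "coeff (shifted_binomial [:-1, 1:] (r + 1) j * shifted_binomial 1 (n - r - 1) (n - j)) n
      = smult (1 / fact j) ([:-1, 1:] ^ j) * smult (1 / fact (n - j)) (1 ^ (n - j))"
      using coeff_mult_top[OF degree_shifted_binomial degree_shifted_binomial]
      by (metis coeff_shifted_binomial)
    then show ?thesis by (simp add: mult.commute)
  qed
  have scalar: "coeff (of_nat s * p) k = of_nat s * coeff p k" for p :: "rat poly poly" and k
    by (simp add: of_nat_poly)
  show ?thesis
    unfolding Lambda_poly_def expected_poly_homog_eq[OF assms] expected_homog_witness_def
      coeff_diff scalar coeff_sum
    using top by (simp add: coeff_shifted_binomial)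
qed

lemma map_poly_of_rat_hom:
  fixes p q :: "rat poly" and x :: "'a::field_char_0"
  shows "poly (map_poly of_rat (p + q)) x = poly (map_poly of_rat p) x + poly (map_poly of_rat q) x"
    and "poly (map_poly of_rat (smult c p)) x = of_rat c * poly (map_poly of_rat p) x"
    and "poly (map_poly of_rat (p * q)) x = poly (map_poly of_rat p) x * poly (map_poly of_rat q) x"
proof -
  have cons: "poly (map_poly of_rat (pCons a p)) x = of_rat a + x * poly (map_poly of_rat p) x"
    for a p by (simp add: map_poly_pCons)
  show add: "poly (map_poly of_rat (p + q)) x = poly (map_poly of_rat p) x + poly (map_poly of_rat q) x"
    for p q :: "rat poly"
    by (induction p q rule: poly_induct2) (simp_all add: cons of_rat_add algebra_simps)
  show smult: "poly (map_poly of_rat (smult c p)) x = of_rat c * poly (map_poly of_rat p) x"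
    for c and p :: "rat poly"
    by (induction p) (simp_all add: cons of_rat_mult algebra_simps)
  show "poly (map_poly of_rat (p * q)) x = poly (map_poly of_rat p) x * poly (map_poly of_rat q) x"
    by (induction p) (simp_all add: cons add smult algebra_simps)
qed

lemma poly_Lambda_poly:
  fixes \<tau> :: real
  assumes "r < n"
  shows "poly (map_poly of_rat (Lambda_poly n r s)) \<tau> = \<tau> ^ n / fact n - real s *
    (\<Sum>j\<le>r. (\<tau> - 1) ^ j / (fact j * fact (n - j)))"
proof -
  define E where "E p = poly (map_poly of_rat p) \<tau>" for p
  note hom = map_poly_of_rat_hom[where x = \<tau>, folded E_def]
  have base: "E 1 = 1" "E 0 = 0" "E [:0, 1:] = \<tau>" "E [:-1, 1:] = \<tau> - 1"
    by (simp_all add: E_def map_poly_pCons)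
  have pow: "E (p ^ k) = E p ^ k" for p k
    by (induction k) (simp_all add: hom base)
  have sum: "E (\<Sum>j\<in>A. f j) = (\<Sum>j\<in>A. E (f j))" for f and A :: "nat set"
    by (induction A rule: infinite_finite_induct) (simp_all add: hom base)
  have diff: "E (p - q) = E p - E q" for p q
    using hom(1)[of "p - q" q] by simp
  have nat: "E (of_nat k) = of_nat k" for k
    by (induction k) (simp_all add: hom base)
  have fact: "of_rat (fact k) = (fact k :: real)" for k
    using of_rat_of_nat_eq[of "fact k", where 'a = real] by simp
  show ?thesis
    unfolding E_def[symmetric] Lambda_poly_eq[OF assms]
    by (simp add: fact hom base pow sum diff nat of_rat_divide of_rat_mult)
qed

text \<open>
  This is the probability that a binomially distributed variable with parameters
  \<open>n\<close> and \<open>1 - u\<close> is at most \<open>r\<close>.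
\<close>

definition binomial_tail :: "nat \<Rightarrow> nat \<Rightarrow> real \<Rightarrow> real" where
  "binomial_tail n r u = (\<Sum>j\<le>r. real (n choose j) * (1 - u) ^ j * u ^ (n - j))"

section \<open>The root of Lambda beyond one\<close>

text \<open>
  In the variable \<open>u = 1 / \<tau>\<close>, which runs through \<open>(0, 1]\<close>, the equation \<open>\<Lambda>(\<tau>) = 0\<close> reads
  \<open>binomial_tail n r u = 1 / s\<close>.
\<close>

lemma poly_Lambda_poly_tail:
  assumes "r < n" "\<tau> > 0"
  shows "poly (map_poly of_rat (Lambda_poly n r s)) \<tau>
    = \<tau> ^ n / fact n * (1 - real s * binomial_tail n r (1 / \<tau>))"
proof -
  have "(\<tau> - 1) ^ j / (fact j * fact (n - j))
      = \<tau> ^ n / fact n * (real (n choose j) * (1 - 1 / \<tau>) ^ j * (1 / \<tau>) ^ (n - j))"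
    if "j \<le> r" for j
  proof -
    have j: "j \<le> n" using that assms by simp
    have "\<tau> - 1 = \<tau> * (1 - 1 / \<tau>)" using assms by (simp add: field_simps)
    then have "(\<tau> - 1) ^ j = \<tau> ^ j * (1 - 1 / \<tau>) ^ j" by (simp add: power_mult_distrib)
    moreover have "\<tau> ^ n = \<tau> ^ j * \<tau> ^ (n - j)" using j by (simp flip: power_add)
    ultimately show ?thesis
      using assms j by (simp add: binomial_fact power_one_over field_simps)
  qed
  then have "(\<Sum>j\<le>r. (\<tau> - 1) ^ j / (fact j * fact (n - j)))
      = \<tau> ^ n / fact n * binomial_tail n r (1 / \<tau>)"
    unfolding binomial_tail_def sum_distrib_left by (intro sum.cong) auto
  then show ?thesis
    unfolding poly_Lambda_poly[OF assms(1)] by (simp add: algebra_simps)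
qed

text \<open>
  The derivatives of consecutive summands cancel up to one term, so the derivative is a multiple
  of a beta density. It is positive on \<open>(0, 1)\<close>.
\<close>

lemma binomial_tail_deriv:
  assumes "r < n"
  shows "(binomial_tail n r has_real_derivative
     real (n - r) * real (n choose r) * (1 - u) ^ r * u ^ (n - r - 1)) (at u)"
  using assms
proof (induction r)
  case 0
  then show ?case
    unfolding binomial_tail_def by (auto intro!: derivative_eq_intros)
next
  case (Suc r)
  then obtain d where d: "n = Suc (Suc (r + d))"
    using less_imp_Suc_add by blast
  have "Suc r * (n choose Suc r) = (n - r) * (n choose r)"
    by (simp only: binomial_absorb_comp binomial_absorption)
  then have absorb: "real (Suc r) * real (n choose Suc r) = real (n - r) * real (n choose r)"
    by (metis of_nat_mult)
  have tail_Suc: "binomial_tail n (Suc r)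
      = (\<lambda>u. binomial_tail n r u + real (n choose Suc r) * (1 - u) ^ Suc r * u ^ (n - Suc r))"
    by (auto simp: binomial_tail_def)
  have pow1: "((\<lambda>u. (1 - u) ^ Suc r) has_real_derivative real (Suc r) * (1 - u) ^ r * (- 1)) (at u)"
  proof -
    have "((\<lambda>u. 1 - u) has_real_derivative - 1) (at u)"
      by (auto intro!: derivative_eq_intros)
    from DERIV_power_Suc[OF this, of r] show ?thesis
      by (simp add: mult.commute del: power_Suc)
  qed
  have pow2: "((\<lambda>u. u ^ (n - Suc r)) has_real_derivative
      real (n - Suc r) * u ^ (n - Suc r - 1)) (at u)"
    using DERIV_pow[of "n - Suc r" u] by simp
  have deriv: "((\<lambda>u. binomial_tail n r u + real (n choose Suc r) * (1 - u) ^ Suc r * u ^ (n - Suc r))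
    has_real_derivative real (n - r) * real (n choose r) * (1 - u) ^ r * u ^ (n - r - 1) +
      (real (n choose Suc r) * (real (Suc r) * (1 - u) ^ r * (- 1)) * u ^ (n - Suc r)
       + real (n - Suc r) * u ^ (n - Suc r - 1) * (real (n choose Suc r) * (1 - u) ^ Suc r))) (at u)"
    using Suc by (intro DERIV_add DERIV_mult DERIV_cmult pow1 pow2) simp
  have eq: "real (n - r) * real (n choose r) * (1 - u) ^ r * u ^ (n - r - 1) +
      (real (n choose Suc r) * (real (Suc r) * (1 - u) ^ r * (- 1)) * u ^ (n - Suc r)
       + real (n - Suc r) * u ^ (n - Suc r - 1) * (real (n choose Suc r) * (1 - u) ^ Suc r))
     = real (n - Suc r) * real (n choose Suc r) * (1 - u) ^ Suc r * u ^ (n - Suc r - 1)"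
    unfolding absorb[symmetric] by (simp add: d algebra_simps)
  show ?case unfolding tail_Suc using deriv unfolding eq .
qed

lemma binomial_tail_0: "r < n \<Longrightarrow> binomial_tail n r 0 = 0"
  unfolding binomial_tail_def by (intro sum.neutral) auto

lemma binomial_tail_1: "binomial_tail n r 1 = 1"
proof -
  have "binomial_tail n r 1 = (\<Sum>j\<in>{0}. real (n choose j) * (1 - 1) ^ j * 1 ^ (n - j))"
    unfolding binomial_tail_def by (intro sum.mono_neutral_right) auto
  then show ?thesis by simp
qed

lemma binomial_tail_less:
  assumes "r < n" "0 \<le> u" "u < v" "v \<le> 1"
  shows "binomial_tail n r u < binomial_tail n r v"
proof (rule DERIV_pos_imp_increasing_open[OF assms(3)])
  fix x assume "u < x" "x < v"
  then have "real (n - r) * real (n choose r) * (1 - x) ^ r * x ^ (n - r - 1) > 0"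
    using assms by simp
  then show "\<exists>y. (binomial_tail n r has_real_derivative y) (at x) \<and> y > 0"
    using binomial_tail_deriv[OF assms(1)] by blast
next
  show "continuous_on {u..v} (binomial_tail n r)"
    using binomial_tail_deriv[OF assms(1)] DERIV_isCont continuous_at_imp_continuous_on by blast
qed

lemma Lambda_roots_iff:
  assumes "r < n" "s \<ge> 1" "\<tau> \<ge> 1"
  shows "\<tau> \<in> Lambda_roots n r s \<longleftrightarrow> binomial_tail n r (1 / \<tau>) = 1 / real s"
  using assms by (simp add: Lambda_roots_def poly_Lambda_poly_tail field_simps)

lemma Lambda_unique_root:
  assumes "r < n" "s \<ge> 1"
  shows "\<exists>!\<tau>. \<tau> \<ge> 1 \<and> \<tau> \<in> Lambda_roots n r s"
proof -
  have "\<exists>u\<ge>0. u \<le> 1 \<and> binomial_tail n r u = 1 / real s"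
  proof (rule IVT)
    show "\<forall>x. 0 \<le> x \<and> x \<le> 1 \<longrightarrow> isCont (binomial_tail n r) x"
      using binomial_tail_deriv[OF assms(1)] DERIV_isCont by blast
  qed (use assms binomial_tail_0[OF assms(1)] binomial_tail_1 in auto)
  then obtain u where u: "0 \<le> u" "u \<le> 1" "binomial_tail n r u = 1 / real s" by blast
  have "u \<noteq> 0" using u binomial_tail_0[OF assms(1)] assms by auto
  show ?thesis
  proof (rule ex1I[of _ "1 / u"])
    show "1 / u \<ge> 1 \<and> 1 / u \<in> Lambda_roots n r s"
      using u \<open>u \<noteq> 0\<close> Lambda_roots_iff[OF assms, of "1 / u"] by simp
  next
    fix \<tau> assume \<tau>: "\<tau> \<ge> 1 \<and> \<tau> \<in> Lambda_roots n r s"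
    then have "binomial_tail n r (1 / \<tau>) = binomial_tail n r u"
      using Lambda_roots_iff[OF assms, of \<tau>] u by simp
    moreover have "0 \<le> 1 / \<tau>" "1 / \<tau> \<le> 1" using \<tau> by auto
    ultimately have "1 / \<tau> = u"
      using binomial_tail_less[OF assms(1), of u "1 / \<tau>"]
        binomial_tail_less[OF assms(1), of "1 / \<tau>" u] u by linarith
    then show "\<tau> = 1 / u" by auto
  qed
qed

lemma Lambda_pos_beyond_root:
  assumes "r < n" "s \<ge> 1" "g \<ge> 1" "g \<in> Lambda_roots n r s" "\<tau> > g"
  shows "poly (map_poly of_rat (Lambda_poly n r s)) \<tau> > 0"
proof -
  have "binomial_tail n r (1 / \<tau>) < binomial_tail n r (1 / g)"
    using assms by (intro binomial_tail_less) (auto simp: field_simps)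
  also have "\<dots> = 1 / real s" using assms Lambda_roots_iff by blast
  finally have "real s * binomial_tail n r (1 / \<tau>) < 1"
    using assms by (simp add: field_simps)
  then show ?thesis using assms by (simp add: poly_Lambda_poly_tail)
qed

section \<open>The expected Waldschmidt constant is at most the root\<close>

lemma expected_poly_eq_choose:
  assumes "r < n" "m \<le> t"
  shows "poly (expected_poly n r s m) (of_nat t) = of_nat ((t + n) choose n) - of_nat s *
    (\<Sum>j\<le>r. of_nat ((t - m + (r + 1)) choose j) * of_nat ((m + (n - r - 1)) choose (n - j)))"
  unfolding poly_expected_poly[OF assms(1)] of_nat_add_choose of_nat_diff[OF assms(2)] by (rule refl)

lemma choose_asymptotics:
  "(\<lambda>k. real ((k * a + c) choose j) / real k ^ j) \<longlonglongrightarrow> real a ^ j / fact j"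
proof -
  have lin: "(\<lambda>k. (real k * real a + d) / real k) \<longlonglongrightarrow> real a" for d
  proof -
    have "(\<lambda>k. real a + d / real k) \<longlonglongrightarrow> real a + 0"
      by (intro tendsto_intros lim_const_over_n)
    moreover have "\<forall>\<^sub>F k in sequentially. real a + d / real k = (real k * real a + d) / real k"
      using eventually_gt_at_top[of 0] by eventually_elim (simp add: add_divide_distrib)
    ultimately show ?thesis by (simp add: tendsto_cong)
  qed
  have "(\<lambda>k. (\<Prod>i\<in>{0..<j}. (real k * real a + (real c - real i)) / real k) / fact j)
      \<longlonglongrightarrow> (\<Prod>i\<in>{0..<j}. real a) / fact j"
    by (intro tendsto_intros lin) auto
  moreover have "(\<Prod>i\<in>{0..<j}. (real k * real a + (real c - real i)) / real k) / fact j
      = real ((k * a + c) choose j) / real k ^ j" for k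
    unfolding binomial_gbinomial gbinomial_prod_rev by (simp add: prod_dividef algebra_simps)
  ultimately show ?thesis by simp
qed

text \<open>
  Along \<open>(t, m) = (k a, k b)\<close> the expected polynomial grows like
  \<open>(k b)\<^sup>n \<Lambda>(a / b)\<close>.
\<close>

lemma expected_poly_eventually_pos:
  assumes "r < n" "b \<ge> 1" "b \<le> a"
    and pos: "poly (map_poly of_rat (Lambda_poly n r s)) (real a / real b) > 0"
  shows "\<exists>k\<ge>1. poly (expected_poly n r s (k * b)) (of_nat (k * a)) > 0"
proof -
  define P where "P k = poly (expected_poly n r s (k * b)) (of_nat (k * a))" for k
  have P: "real_of_rat (P k) / real k ^ n = real ((k * a + n) choose n) / real k ^ n - real s *
    (\<Sum>j\<le>r. (real ((k * (a - b) + (r + 1)) choose j) / real k ^ j)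
       * (real ((k * b + (n - r - 1)) choose (n - j)) / real k ^ (n - j)))" for k
  proof -
    have "real k ^ n = real k ^ j * real k ^ (n - j)" if "j \<le> r" for j
      using that assms by (simp flip: power_add)
    then have "(\<Sum>j\<le>r. (real ((k * (a - b) + (r + 1)) choose j) / real k ^ j)
       * (real ((k * b + (n - r - 1)) choose (n - j)) / real k ^ (n - j)))
      = (\<Sum>j\<le>r. real ((k * (a - b) + (r + 1)) choose j) * real ((k * b + (n - r - 1)) choose (n - j)))
         / real k ^ n"
      unfolding sum_divide_distrib by (intro sum.cong) auto
    moreover have "k * b \<le> k * a" "k * a - k * b = k * (a - b)"
      using assms by (auto simp: diff_mult_distrib2)
    ultimately show ?thesis
      using assms unfolding P_def
      by (simp add: expected_poly_eq_choose of_rat_diff of_rat_mult of_rat_sum diff_divide_distrib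
          del: of_nat_mult of_nat_add)
  qed
  have "(\<lambda>k. real_of_rat (P k) / real k ^ n) \<longlonglongrightarrow> real a ^ n / fact n - real s *
    (\<Sum>j\<le>r. real (a - b) ^ j / fact j * (real b ^ (n - j) / fact (n - j)))"
    unfolding P by (intro tendsto_intros choose_asymptotics)
  also have "real a ^ n / fact n - real s *
    (\<Sum>j\<le>r. real (a - b) ^ j / fact j * (real b ^ (n - j) / fact (n - j)))
     = real b ^ n * poly (map_poly of_rat (Lambda_poly n r s)) (real a / real b)"
  proof -
    have "real (a - b) ^ j / fact j * (real b ^ (n - j) / fact (n - j))
       = real b ^ n * ((real a / real b - 1) ^ j / (fact j * fact (n - j)))" if "j \<le> r" for j
    proof -
      have "real b ^ n = real b ^ j * real b ^ (n - j)"
        using that assms by (simp flip: power_add)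
      moreover have "real (a - b) = real b * (real a / real b - 1)"
        using assms by (simp add: of_nat_diff field_simps)
      ultimately show ?thesis by (simp add: power_mult_distrib)
    qed
    then have "(\<Sum>j\<le>r. real (a - b) ^ j / fact j * (real b ^ (n - j) / fact (n - j)))
      = real b ^ n * (\<Sum>j\<le>r. (real a / real b - 1) ^ j / (fact j * fact (n - j)))"
      unfolding sum_distrib_left by (intro sum.cong) auto
    then show ?thesis
      using assms unfolding poly_Lambda_poly[OF assms(1)]
      by (simp add: power_divide algebra_simps)
  qed
  finally have "\<forall>\<^sub>F k in sequentially. real_of_rat (P k) / real k ^ n > 0"
    by (rule order_tendstoD(1)) (use pos assms in simp)
  then obtain K where "\<And>k. k \<ge> K \<Longrightarrow> real_of_rat (P k) / real k ^ n > 0"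
    unfolding eventually_sequentially by blast
  from this[of "Suc K"] have "P (Suc K) > 0"
    by (simp add: zero_less_divide_iff)
  then show ?thesis unfolding P_def by (intro exI[of _ "Suc K"]) simp
qed

lemma expected_ratio_below:
  assumes "r < n" "s \<ge> 1" "g \<ge> 1" "g \<in> Lambda_roots n r s" "x > g"
  shows "\<exists>t m. t \<ge> m \<and> m \<ge> 1 \<and> poly (expected_poly n r s m) (of_nat t) > 0 \<and> real t / real m < x"
proof -
  obtain q where q: "q \<in> \<rat>" "g < q" "q < x" using Rats_dense_in_real assms(5) by blast
  then obtain a b where ab: "b \<noteq> 0" "\<bar>q\<bar> = real a / real b" by (metis Rats_abs_nat_div_natE)
  then have q_eq: "q = real a / real b" and b: "b \<ge> 1" using q assms by auto
  have "1 * real b \<le> q * real b" using q assms by (intro mult_right_mono) auto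
  also have "\<dots> = real a" using q_eq b by simp
  finally have le: "b \<le> a" by simp
  have "poly (map_poly of_rat (Lambda_poly n r s)) (real a / real b) > 0"
    using Lambda_pos_beyond_root[OF assms(1-4)] q q_eq by blast
  then obtain k where k: "k \<ge> 1" "poly (expected_poly n r s (k * b)) (of_nat (k * a)) > 0"
    using expected_poly_eventually_pos[OF assms(1) b le] by blast
  then have "real (k * a) / real (k * b) = q" using q_eq by simp
  then show ?thesis using k b le q by (intro exI[of _ "k * a"] exI[of _ "k * b"]) auto
qed

lemma expected_waldschmidt_le_root:
  assumes "r < n" "s \<ge> 1" "g \<ge> 1" "g \<in> Lambda_roots n r s"
  shows "expected_waldschmidt n r s \<le> g"
proof (rule dense_ge)
  let ?S = "{real t / real m |t m. t \<ge> m \<and> m \<ge> 1 \<and> poly (expected_poly n r s m) (of_nat t) > 0}"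
  fix x assume "g < x"
  then obtain t m where tm: "t \<ge> m \<and> m \<ge> 1 \<and> poly (expected_poly n r s m) (of_nat t) > 0"
    "real t / real m < x" using expected_ratio_below[OF assms] by blast
  then have "real t / real m \<in> ?S" by blast
  moreover have "bdd_below ?S" by (rule bdd_belowI[of _ 0]) auto
  ultimately have "expected_waldschmidt n r s \<le> real t / real m"
    unfolding expected_waldschmidt_def by (rule cInf_lower)
  then show "expected_waldschmidt n r s \<le> x" using tm(2) by simp
qed

section \<open>Evaluation of polynomials\<close>

text \<open>
  The homomorphism from the polynomial ring that is \<open>c\<close> on constants and sends the variable
  \<open>i\<close> to \<open>\<sigma> i\<close>. Evaluation at a point, restriction to a curve and linear substitution
  are instances.
\<close>

definition eval_hom ::
    "('k::comm_ring_1 \<Rightarrow> 'a::comm_ring_1) \<Rightarrow> ('n::finite \<Rightarrow> 'a) \<Rightarrow> ('n, 'k) mpoly \<Rightarrow> 'a" where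
  "eval_hom c \<sigma> f = (\<Sum>u\<in>Poly_Mapping.keys f.
     c (Poly_Mapping.lookup f u) * (\<Prod>i\<in>UNIV. \<sigma> i ^ Poly_Mapping.lookup u i))"

locale coeff_hom =
  fixes c :: "'k::comm_ring_1 \<Rightarrow> 'a::comm_ring_1"
  assumes add: "c (a + b) = c a + c b"
    and mult: "c (a * b) = c a * c b"
    and one: "c 1 = 1"
begin

lemma zero: "c 0 = 0"
  using add[of 0 0] by simp

lemma eval_hom_superset:
  assumes "finite K" "Poly_Mapping.keys f \<subseteq> K"
  shows "eval_hom c \<sigma> f = (\<Sum>u\<in>K.
     c (Poly_Mapping.lookup f u) * (\<Prod>i\<in>UNIV. \<sigma> i ^ Poly_Mapping.lookup u i))"
  unfolding eval_hom_def using assms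
  by (intro sum.mono_neutral_left) (auto simp: in_keys_iff zero)

lemma eval_hom_add: "eval_hom c \<sigma> (f + g) = eval_hom c \<sigma> f + eval_hom c \<sigma> g"
proof -
  let ?K = "Poly_Mapping.keys f \<union> Poly_Mapping.keys g"
  have K: "finite ?K" "Poly_Mapping.keys (f + g) \<subseteq> ?K" by (auto simp: keys_add)
  show ?thesis
    unfolding eval_hom_superset[OF K] eval_hom_superset[OF K(1) Un_upper1]
      eval_hom_superset[OF K(1) Un_upper2] sum.distrib[symmetric]
    by (simp add: lookup_add add algebra_simps)
qed

lemma eval_hom_zero: "eval_hom c \<sigma> 0 = 0"
  by (simp add: eval_hom_def)

lemma eval_hom_single:
  "eval_hom c \<sigma> (Poly_Mapping.single u a) = c a * (\<Prod>i\<in>UNIV. \<sigma> i ^ Poly_Mapping.lookup u i)"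
  by (simp add: eval_hom_def zero)

lemma eval_hom_sum: "eval_hom c \<sigma> (\<Sum>x\<in>A. F x) = (\<Sum>x\<in>A. eval_hom c \<sigma> (F x))"
  by (induction A rule: infinite_finite_induct) (simp_all add: eval_hom_zero eval_hom_add)

end

lemma sum_singles: "(\<Sum>u\<in>Poly_Mapping.keys f. Poly_Mapping.single u (Poly_Mapping.lookup f u)) = f"
proof (rule poly_mapping_eqI)
  fix k
  have "(\<Sum>u\<in>Poly_Mapping.keys f. Poly_Mapping.lookup f u when u = k) = Poly_Mapping.lookup f k"
    by (cases "k \<in> Poly_Mapping.keys f")
      (auto simp: when_def sum.delta in_keys_iff intro!: sum.neutral)
  then show "Poly_Mapping.lookup
      (\<Sum>u\<in>Poly_Mapping.keys f. Poly_Mapping.single u (Poly_Mapping.lookup f u)) k = Poly_Mapping.lookup f k"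
    by (simp add: lookup_sum lookup_single)
qed

context coeff_hom
begin

lemma eval_hom_mult: "eval_hom c \<sigma> (f * g) = eval_hom c \<sigma> f * eval_hom c \<sigma> g"
proof -
  let ?s = "\<lambda>f u. Poly_Mapping.single u (Poly_Mapping.lookup f u)"
  have "f * g = (\<Sum>u\<in>Poly_Mapping.keys f. \<Sum>v\<in>Poly_Mapping.keys g. ?s f u * ?s g v)"
    by (simp only: sum_singles sum_product[symmetric])
  then have "eval_hom c \<sigma> (f * g)
      = (\<Sum>u\<in>Poly_Mapping.keys f. \<Sum>v\<in>Poly_Mapping.keys g. eval_hom c \<sigma> (?s f u * ?s g v))"
    by (simp only: eval_hom_sum)
  also have "\<dots> = (\<Sum>u\<in>Poly_Mapping.keys f. \<Sum>v\<in>Poly_Mapping.keys g.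
      eval_hom c \<sigma> (?s f u) * eval_hom c \<sigma> (?s g v))"
    by (simp add: mult_single eval_hom_single mult lookup_add power_add prod.distrib mult.assoc
        mult.left_commute)
  also have "\<dots> = eval_hom c \<sigma> (\<Sum>u\<in>Poly_Mapping.keys f. ?s f u)
      * eval_hom c \<sigma> (\<Sum>v\<in>Poly_Mapping.keys g. ?s g v)"
    by (simp only: eval_hom_sum sum_product)
  finally show ?thesis by (simp only: sum_singles)
qed

lemma eval_hom_one: "eval_hom c \<sigma> 1 = 1"
  unfolding single_one[symmetric] eval_hom_single by (simp add: one)

lemma eval_hom_uminus: "eval_hom c \<sigma> (- f) = - eval_hom c \<sigma> f"
  using eval_hom_add[of \<sigma> f "- f"] by (simp add: eval_hom_zero minus_unique[symmetric])

lemma eval_hom_diff: "eval_hom c \<sigma> (f - g) = eval_hom c \<sigma> f - eval_hom c \<sigma> g"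
  using eval_hom_add[of \<sigma> f "- g"] by (simp add: eval_hom_uminus)

end

lemma eval_mpoly_eq: "eval_mpoly f x = eval_hom (\<lambda>a. a) (\<lambda>i. x $ i) f"
  by (simp add: eval_mpoly_def eval_hom_def)

lemma coeff_hom_id: "coeff_hom (\<lambda>a. a)"
  by unfold_locales auto

lemma coeff_hom_single: "coeff_hom (Poly_Mapping.single (0 :: 'n \<Rightarrow>\<^sub>0 nat))"
  by unfold_locales (auto simp: single_add mult_single)

text \<open>
  The left-hand side is the restriction of \<open>f\<close> to the polynomial curve \<open>\<sigma>\<close>. Such
  restrictions reduce statements about polynomials in many variables to the count of roots of
  polynomials in one.
\<close>

lemma poly_eval_hom:
  "poly (eval_hom (\<lambda>a. [:a:]) \<sigma> f) z = eval_mpoly f (\<chi> i. poly (\<sigma> i) z)"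
  by (simp add: eval_mpoly_def eval_hom_def poly_sum poly_prod)

lemma eval_mpoly_single:
  "eval_mpoly (Poly_Mapping.single u a) x = a * (\<Prod>i\<in>UNIV. (x $ i) ^ Poly_Mapping.lookup u i)"
  unfolding eval_mpoly_eq by (rule coeff_hom.eval_hom_single[OF coeff_hom_id])

lemma
  shows eval_mpoly_add: "eval_mpoly (f + g) x = eval_mpoly f x + eval_mpoly g x"
    and eval_mpoly_diff: "eval_mpoly (f - g) x = eval_mpoly f x - eval_mpoly g x"
    and eval_mpoly_mult: "eval_mpoly (f * g) x = eval_mpoly f x * eval_mpoly g x"
    and eval_mpoly_zero: "eval_mpoly 0 x = 0"
    and eval_mpoly_one: "eval_mpoly 1 x = 1"
    and eval_mpoly_sum: "eval_mpoly (\<Sum>a\<in>A. F a) x = (\<Sum>a\<in>A. eval_mpoly (F a) x)"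
  unfolding eval_mpoly_eq
  by (rule coeff_hom.eval_hom_add[OF coeff_hom_id] coeff_hom.eval_hom_diff[OF coeff_hom_id]
      coeff_hom.eval_hom_mult[OF coeff_hom_id] coeff_hom.eval_hom_zero[OF coeff_hom_id]
      coeff_hom.eval_hom_one[OF coeff_hom_id] coeff_hom.eval_hom_sum[OF coeff_hom_id])+

lemma eval_mpoly_power: "eval_mpoly (f ^ k) x = eval_mpoly f x ^ k"
  by (induction k) (simp_all add: eval_mpoly_one eval_mpoly_mult)

lemma eval_mpoly_prod: "eval_mpoly (\<Prod>a\<in>A. F a) x = (\<Prod>a\<in>A. eval_mpoly (F a) x)"
  by (induction A rule: infinite_finite_induct) (simp_all add: eval_mpoly_one eval_mpoly_mult)

lemma eval_mpoly_eval_hom_single: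
  "eval_mpoly (eval_hom (Poly_Mapping.single 0) \<sigma> f) x = eval_mpoly f (\<chi> i. eval_mpoly (\<sigma> i) x)"
  by (simp add: eval_hom_def eval_mpoly_def[of f] eval_mpoly_sum eval_mpoly_mult eval_mpoly_prod
      eval_mpoly_power eval_mpoly_single)

text \<open>
  Base \<open>B\<close> digits: some weights distinguish all vectors with entries below \<open>B\<close>. Each new
  coordinate gets weight 1 while the old weights are multiplied by \<open>B\<close>, so that it can be read
  off modulo \<open>B\<close>.
\<close>

lemma injective_weights:
  fixes B :: nat
  assumes "finite A"
  shows "\<exists>e :: 'n \<Rightarrow> nat. \<forall>u v. (\<forall>i\<in>A. u i < B \<and> v i < B) \<longrightarrow>
    (\<Sum>i\<in>A. e i * u i) = (\<Sum>i\<in>A. e i * v i) \<longrightarrow> (\<forall>i\<in>A. u i = v i)"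
  using assms
proof (induction A)
  case empty
  then show ?case by simp
next
  case (insert a A)
  then obtain e :: "'n \<Rightarrow> nat" where e: "\<And>u v. \<lbrakk>\<forall>i\<in>A. u i < B \<and> v i < B;
    (\<Sum>i\<in>A. e i * u i) = (\<Sum>i\<in>A. e i * v i)\<rbrakk> \<Longrightarrow> \<forall>i\<in>A. u i = v i" by blast
  define e' where "e' i = (if i = a then 1 else B * e i)" for i
  have e'_sum: "(\<Sum>i\<in>insert a A. e' i * u i) = u a + B * (\<Sum>i\<in>A. e i * u i)" for u :: "'n \<Rightarrow> nat"
  proof -
    have "(\<Sum>i\<in>A. e' i * u i) = (\<Sum>i\<in>A. B * (e i * u i))"
      using insert by (intro sum.cong) (auto simp: e'_def)
    then show ?thesis using insert by (simp add: e'_def sum_distrib_left)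
  qed
  have "\<forall>i\<in>insert a A. u i = v i"
    if bound: "\<forall>i\<in>insert a A. u i < B \<and> v i < B"
      and eq: "(\<Sum>i\<in>insert a A. e' i * u i) = (\<Sum>i\<in>insert a A. e' i * v i)" for u v
  proof -
    have eq': "u a + B * (\<Sum>i\<in>A. e i * u i) = v a + B * (\<Sum>i\<in>A. e i * v i)"
      using eq by (simp only: e'_sum)
    then have "(u a + B * (\<Sum>i\<in>A. e i * u i)) mod B = (v a + B * (\<Sum>i\<in>A. e i * v i)) mod B"
      by simp
    then have a: "u a = v a" using bound by simp
    moreover have "B > 0" using bound by auto
    ultimately have "(\<Sum>i\<in>A. e i * u i) = (\<Sum>i\<in>A. e i * v i)" using eq' by simp
    then show ?thesis using e[of u v] bound a by auto
  qed
  then show ?case by blast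
qed

lemma poly_nonroot:
  fixes p :: "'k::idom poly"
  assumes "infinite (UNIV :: 'k set)" "p \<noteq> 0"
  obtains z where "poly p z \<noteq> 0"
  using assms poly_roots_finite[of p] by (metis (mono_tags, lifting) UNIV_eq_I mem_Collect_eq)

text \<open>
  Kronecker substitution: send the variable \<open>i\<close> to \<open>z\<close> to the power \<open>e i\<close> with weights \<open>e\<close> that
  separate the exponents of \<open>f\<close>. Distinct monomials go to distinct powers of \<open>z\<close>, so the image is
  a nonzero polynomial in one variable, and over an infinite domain it has a nonroot.
\<close>

lemma mpoly_nonzero_value:
  fixes f :: "('n::finite, 'k::idom) mpoly"
  assumes "infinite (UNIV :: 'k set)" "f \<noteq> 0"
  obtains x where "eval_mpoly f x \<noteq> 0"
proof -
  let ?l = Poly_Mapping.lookup and ?K = "Poly_Mapping.keys f"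
  define B where "B = Suc (Max ((\<lambda>(u, i). ?l u i) ` (?K \<times> UNIV)))"
  have B: "?l u i < B" if "u \<in> ?K" for u i
    unfolding B_def less_Suc_eq_le using that by (intro Max_ge) auto
  obtain e :: "'n \<Rightarrow> nat" where e: "\<forall>u v. (\<forall>i\<in>UNIV. u i < B \<and> v i < B) \<longrightarrow>
    (\<Sum>i\<in>UNIV. e i * u i) = (\<Sum>i\<in>UNIV. e i * v i) \<longrightarrow> (\<forall>i\<in>UNIV. u i = v i)"
    using injective_weights[OF finite, of UNIV B] by blast
  define w where "w u = (\<Sum>i\<in>UNIV. e i * ?l u i)" for u
  have w: "u = v" if "u \<in> ?K" "v \<in> ?K" "w u = w v" for u v
    using e[rule_format, of "?l u" "?l v"] that B by (auto simp: w_def intro: poly_mapping_eqI)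
  define p where "p = eval_hom (\<lambda>a. [:a:]) (\<lambda>i. monom 1 (e i)) f"
  have p: "p = (\<Sum>u\<in>?K. monom (?l f u) (w u))"
  proof -
    have "(\<Prod>i\<in>A. monom (1::'k) (e i) ^ ?l u i) = monom 1 (\<Sum>i\<in>A. e i * ?l u i)"
      if "finite A" for u A
      using that by induction (simp_all add: monom_power mult_monom)
    then show ?thesis
      unfolding p_def eval_hom_def w_def by (simp add: smult_monom)
  qed
  obtain u0 where u0: "u0 \<in> ?K" using assms by (metis ex_in_conv keys_eq_empty)
  have "coeff p (w u0) = (\<Sum>u\<in>?K. if u = u0 then ?l f u else 0)"
    unfolding p coeff_sum using w u0 by (intro sum.cong) auto
  also have "\<dots> = ?l f u0" using u0 by (simp add: sum.delta)
  finally have "p \<noteq> 0" using u0 by (auto simp: in_keys_iff)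
  then obtain z where "poly p z \<noteq> 0" using poly_nonroot assms by blast
  then show ?thesis using that unfolding p_def poly_eval_hom by blast
qed

text \<open>
  If \<open>f\<close> is nonzero at \<open>x\<close> and \<open>g\<close> is nonzero at \<open>y\<close>, then on the line through \<open>x\<close> and
  \<open>y\<close> both restrict to nonzero polynomials in one variable, whose product cannot vanish everywhere.
\<close>

lemma eval_mpoly_no_zero_divisors_on:
  fixes f g :: "('n::finite, 'k::idom) mpoly"
  assumes "infinite (UNIV :: 'k set)"
    and lines: "\<And>x y z. x \<in> V \<Longrightarrow> y \<in> V \<Longrightarrow> x + z *s (y - x) \<in> V"
    and fg: "\<And>x. x \<in> V \<Longrightarrow> eval_mpoly f x * eval_mpoly g x = 0"
  shows "(\<forall>x\<in>V. eval_mpoly f x = 0) \<or> (\<forall>x\<in>V. eval_mpoly g x = 0)"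
proof (rule ccontr)
  assume "\<not> ?thesis"
  then obtain x y where xy: "x \<in> V" "y \<in> V" "eval_mpoly f x \<noteq> 0" "eval_mpoly g y \<noteq> 0" by blast
  define line where "line h = eval_hom (\<lambda>a. [:a:]) (\<lambda>i. [:x $ i, y $ i - x $ i:]) h"
    for h :: "('n, 'k) mpoly"
  have line: "poly (line h) z = eval_mpoly h (x + z *s (y - x))" for h z
  proof -
    have "(\<chi> i. poly [:x $ i, y $ i - x $ i:] z) = x + z *s (y - x)" by (simp add: vec_eq_iff algebra_simps)
    then show ?thesis unfolding line_def poly_eval_hom by simp
  qed
  have "poly (line f * line g) z = 0" for z
    using lines[OF xy(1,2)] fg by (simp add: line)
  then have "line f * line g = 0" using poly_nonroot[OF assms(1)] by metis
  moreover have "line f \<noteq> 0" using line[of f 0] xy by auto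
  moreover have "line g \<noteq> 0" using line[of g 1] xy by auto
  ultimately show False by simp
qed

lemma mpoly_mult_nonzero:
  fixes f g :: "('n::finite, 'k::idom) mpoly"
  assumes "infinite (UNIV :: 'k set)" "f \<noteq> 0" "g \<noteq> 0"
  shows "f * g \<noteq> 0"
proof
  assume "f * g = 0"
  then have "eval_mpoly f x * eval_mpoly g x = 0" for x
    by (metis eval_mpoly_mult eval_mpoly_zero)
  then have "(\<forall>x. eval_mpoly f x = 0) \<or> (\<forall>x. eval_mpoly g x = 0)"
    using eval_mpoly_no_zero_divisors_on[OF assms(1), of UNIV f g] by simp
  then show False using assms mpoly_nonzero_value by metis
qed

text \<open>
  Over a finite field the polynomial \<open>1 + \<Prod>a. (X - a)\<close> has the constant value 1 and no root.
\<close>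

lemma infinite_UNIV_alg_closed: "infinite (UNIV :: 'k::alg_closed_field set)"
proof
  assume fin: "finite (UNIV :: 'k set)"
  define p :: "'k poly" where "p = (\<Prod>a\<in>UNIV. [:- a, 1:]) + 1"
  have deg: "degree (\<Prod>a\<in>(UNIV::'k set). [:- a, 1:]) = card (UNIV :: 'k set)"
    by (subst degree_prod_eq_sum_degree) auto
  have "degree p > 0"
    unfolding p_def using fin deg by (subst degree_add_eq_left) (auto simp: card_gt_0_iff)
  then obtain z where "poly p z = 0" using alg_closed_imp_poly_has_root by blast
  moreover have "poly p z = 1" using fin by (auto simp: p_def poly_prod intro!: prod_zero)
  ultimately show False by simp
qed

section \<open>Forms and vanishing ideals\<close>

lemma form_zero: "form d 0"
  by (simp add: form_def)

lemma form_add: "form d f \<Longrightarrow> form d g \<Longrightarrow> form d (f + g)"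
  using keys_add[of f g] by (auto simp: form_def)

lemma form_sum: "(\<And>a. a \<in> A \<Longrightarrow> form d (F a)) \<Longrightarrow> form d (\<Sum>a\<in>A. F a)"
  by (induction A rule: infinite_finite_induct) (auto simp: form_zero form_add)

lemma form_single: "(\<Sum>i\<in>UNIV. Poly_Mapping.lookup u i) = d \<Longrightarrow> form d (Poly_Mapping.single u a)"
  by (simp add: form_def)

lemma form_mult:
  assumes "form d f" "form e g"
  shows "form (d + e) (f * g)"
  unfolding form_def
proof
  fix w assume "w \<in> Poly_Mapping.keys (f * g)"
  then obtain u v where "w = u + v" "u \<in> Poly_Mapping.keys f" "v \<in> Poly_Mapping.keys g"
    using keys_mult[of f g] by blast
  then show "(\<Sum>i\<in>UNIV. Poly_Mapping.lookup w i) = d + e"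
    using assms by (auto simp: form_def lookup_add sum.distrib)
qed

lemma form_one: "form 0 1"
  unfolding single_one[symmetric] by (rule form_single) simp

lemma form_prod:
  "(\<And>a. a \<in> A \<Longrightarrow> form (d a) (F a)) \<Longrightarrow> form (\<Sum>a\<in>A. d a) (\<Prod>a\<in>A. F a)"
  by (induction A rule: infinite_finite_induct) (auto simp: form_one form_mult)

lemma form_power: "form d f \<Longrightarrow> form (k * d) (f ^ k)"
  by (induction k) (auto simp: form_one form_mult)

definition homogeneous_part :: "nat \<Rightarrow> ('n::finite, 'k::comm_ring_1) mpoly \<Rightarrow> ('n, 'k) mpoly" where
  "homogeneous_part d f = (\<Sum>u\<in>{u\<in>Poly_Mapping.keys f. (\<Sum>i\<in>UNIV. Poly_Mapping.lookup u i) = d}.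
     Poly_Mapping.single u (Poly_Mapping.lookup f u))"

lemma form_homogeneous_part: "form d (homogeneous_part d f)"
  unfolding homogeneous_part_def by (intro form_sum form_single) auto

lemma sum_homogeneous_parts:
  obtains D where "f = (\<Sum>d\<le>D. homogeneous_part d f)"
proof
  let ?deg = "\<lambda>u. \<Sum>i\<in>UNIV. Poly_Mapping.lookup u i"
  have "(\<Sum>d\<le>Max (?deg ` Poly_Mapping.keys f). homogeneous_part d f)
      = (\<Sum>u\<in>Poly_Mapping.keys f. Poly_Mapping.single u (Poly_Mapping.lookup f u))"
    unfolding homogeneous_part_def by (intro sum.group) auto
  then show "f = (\<Sum>d\<le>Max (?deg ` Poly_Mapping.keys f). homogeneous_part d f)"
    by (simp add: sum_singles)
qed

lemma eval_mpoly_form_scale: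
  assumes "form d f"
  shows "eval_mpoly f (z *s x) = z ^ d * eval_mpoly f x"
proof -
  have "(\<Prod>i\<in>UNIV. ((z *s x) $ i) ^ Poly_Mapping.lookup u i)
      = z ^ d * (\<Prod>i\<in>UNIV. (x $ i) ^ Poly_Mapping.lookup u i)" if "u \<in> Poly_Mapping.keys f" for u
  proof -
    have "(\<Sum>i\<in>UNIV. Poly_Mapping.lookup u i) = d" using assms that by (auto simp: form_def)
    then show ?thesis by (auto simp: power_mult_distrib prod.distrib power_sum)
  qed
  then show ?thesis
    unfolding eval_mpoly_def sum_distrib_left by (intro sum.cong) (auto simp: mult_ac)
qed

interpretation self_module: module "(*) :: 'a::comm_ring_1 \<Rightarrow> 'a \<Rightarrow> 'a"
  by unfold_locales (simp_all add: algebra_simps)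

(* As a rewrite rule, this instance of associativity undoes mult.assoc. *)
declare self_module.scale_scale [simp del]

definition vanishing_on :: "('k::comm_ring_1 ^ 'n::finite) set \<Rightarrow> ('n, 'k) mpoly set" where
  "vanishing_on V = {f. \<forall>x\<in>V. eval_mpoly f x = 0}"

lemma subspace_vanishing_on: "self_module.subspace (vanishing_on V)"
  by (rule self_module.subspaceI)
    (auto simp: vanishing_on_def eval_mpoly_zero eval_mpoly_add eval_mpoly_mult)

text \<open>
  Along the line spanned by \<open>x\<close>, the function \<open>z \<mapsto> f (z x)\<close> is a polynomial in \<open>z\<close> whose
  coefficients are the values at \<open>x\<close> of the homogeneous parts of \<open>f\<close>. It vanishes identically.
\<close>

lemma homogeneous_part_vanishing_on:
  fixes V :: "('k::field ^ 'n::finite) set"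
  assumes "infinite (UNIV :: 'k set)" and V: "vec.subspace V" and f: "f \<in> vanishing_on V"
    and D: "f = (\<Sum>d\<le>D. homogeneous_part d f)" and d: "d \<le> D"
  shows "homogeneous_part d f \<in> vanishing_on V"
proof -
  have "eval_mpoly (homogeneous_part d f) x = 0" if x: "x \<in> V" for x
  proof -
    define p where "p = (\<Sum>d\<le>D. monom (eval_mpoly (homogeneous_part d f) x) d)"
    have "poly p z = 0" for z
    proof -
      have "poly p z = eval_mpoly (\<Sum>d\<le>D. homogeneous_part d f) (z *s x)"
        by (simp add: p_def poly_sum poly_monom eval_mpoly_sum mult.commute
            eval_mpoly_form_scale[OF form_homogeneous_part])
      also have "\<dots> = 0"
        unfolding D[symmetric] using f V x vec.subspace_scale by (auto simp: vanishing_on_def)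
      finally show ?thesis .
    qed
    then have "p = 0" using poly_nonroot[OF assms(1)] by metis
    then have "coeff p d = 0" by simp
    then show ?thesis using d by (simp add: p_def coeff_sum)
  qed
  then show ?thesis by (simp add: vanishing_on_def)
qed

lemma projective_point_span: "x \<noteq> 0 \<Longrightarrow> vec.span {x} \<in> projective_points"
  by (simp add: projective_points_def vec.dim_span)

text \<open>
  An ideal of functions that vanish on a cone is generated by its homogeneous elements, and a form
  that vanishes at the nonzero points of \<open>V\<close> also vanishes at the origin: this is automatic in
  positive degree, and a constant that vanishes somewhere is zero.
\<close>

lemma vanishing_ideal_eq:
  fixes V :: "('k::field ^ 'n::finite) set"
  assumes inf: "infinite (UNIV :: 'k set)" and V: "vec.subspace V" "V \<noteq> {0}"
  shows "vanishing_ideal {p \<in> projective_points. p \<subseteq> V} = vanishing_on V"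
proof -
  let ?L = "{p \<in> projective_points. p \<subseteq> V}"
  let ?G = "{f. (\<exists>d. form d f) \<and> (\<forall>p\<in>?L. \<forall>x\<in>p - {0}. eval_mpoly f x = 0)}"
  obtain x0 where x0: "x0 \<in> V" "x0 \<noteq> 0" using V vec.subspace_0 by blast
  have G: "f \<in> vanishing_on V" if f: "f \<in> ?G" for f
  proof -
    obtain d where d: "form d f" using f by blast
    have nonzero: "eval_mpoly f x = 0" if "x \<in> V" "x \<noteq> 0" for x
    proof -
      have "vec.span {x} \<in> ?L"
        using that V by (auto simp: projective_point_span vec.span_minimal)
      moreover have "x \<in> vec.span {x} - {0}" using that by (simp add: vec.span_base)
      ultimately show ?thesis using f by blast
    qed
    have "eval_mpoly f 0 = 0 ^ d * eval_mpoly f x0"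
      using eval_mpoly_form_scale[OF d, of 0 x0] by simp
    also have "\<dots> = 0" using nonzero x0 by simp
    finally show ?thesis using nonzero by (auto simp: vanishing_on_def)
  qed
  have "f \<in> self_module.span ?G" if f: "f \<in> vanishing_on V" for f
  proof -
    obtain D where D: "f = (\<Sum>d\<le>D. homogeneous_part d f)" using sum_homogeneous_parts .
    have "homogeneous_part d f \<in> ?G" if "d \<le> D" for d
      using homogeneous_part_vanishing_on[OF inf V(1) f D that] form_homogeneous_part
      by (auto simp: vanishing_on_def)
    then have "(\<Sum>d\<le>D. homogeneous_part d f) \<in> self_module.span ?G"
      by (intro self_module.span_sum self_module.span_base) auto
    then show ?thesis using D by simp
  qed
  moreover have "self_module.span ?G \<subseteq> vanishing_on V"
    using G subspace_vanishing_on by (intro self_module.span_minimal) auto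
  ultimately show ?thesis unfolding vanishing_ideal_def ideal_generated_def by blast
qed

lemma prime_vanishing_on:
  fixes V :: "('k::field ^ 'n::finite) set"
  assumes inf: "infinite (UNIV :: 'k set)" and V: "vec.subspace V"
  shows "prime_ideal (vanishing_on V)"
  unfolding prime_ideal_def
proof (intro conjI allI impI)
  show "self_module.subspace (vanishing_on V)" by (rule subspace_vanishing_on)
  have "eval_mpoly 1 (0 :: 'k ^ 'n) \<noteq> 0" by (simp add: eval_mpoly_one)
  then show "vanishing_on V \<noteq> UNIV"
    using vec.subspace_0[OF V] unfolding vanishing_on_def by blast
next
  fix f g assume "f * g \<in> vanishing_on V"
  then have "eval_mpoly f x * eval_mpoly g x = 0" if "x \<in> V" for x
    using that by (auto simp: vanishing_on_def eval_mpoly_mult)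
  then show "f \<in> vanishing_on V \<or> g \<in> vanishing_on V"
    using eval_mpoly_no_zero_divisors_on[OF inf, of V f g] V
    by (simp add: vanishing_on_def vec.subspace_add vec.subspace_scale vec.subspace_diff)
qed

section \<open>Symbolic powers and the Waldschmidt constant\<close>

(* With J to the power Suc m kept folded, the lemmas on ideal powers apply to it. *)
declare ideal_power.simps(2) [simp del]

lemma subspace_ideal_power: "self_module.subspace (ideal_power J m)"
  by (cases m) (simp_all add: ideal_power.simps(2) ideal_generated_def)

lemma ideal_power_SucI: "a \<in> J \<Longrightarrow> b \<in> ideal_power J m \<Longrightarrow> a * b \<in> ideal_power J (Suc m)"
  unfolding ideal_power.simps ideal_generated_def by (intro self_module.span_base) blast

lemma ideal_power_absorb: "b \<in> ideal_power J m \<Longrightarrow> a * b \<in> ideal_power J m"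
  using self_module.subspace_scale[OF subspace_ideal_power] by blast

lemma ideal_power_Suc_induct [consumes 1, case_names zero add mult]:
  assumes "x \<in> ideal_power J (Suc m)"
    and "P 0" "\<And>x y. P x \<Longrightarrow> P y \<Longrightarrow> P (x + y)"
    and "\<And>c a b. a \<in> J \<Longrightarrow> b \<in> ideal_power J m \<Longrightarrow> P (c * (a * b))"
  shows "P x"
proof -
  have "x \<in> self_module.span {a * b |a b. a \<in> J \<and> b \<in> ideal_power J m}"
    using assms(1) by (simp add: ideal_power.simps(2) ideal_generated_def)
  then show ?thesis
    by (induction rule: self_module.span_induct_alt) (use assms in auto)
qed

lemma ideal_power_mult:
  "a \<in> ideal_power J m \<Longrightarrow> b \<in> ideal_power J k \<Longrightarrow> a * b \<in> ideal_power J (m + k)"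
proof (induction m arbitrary: a)
  case 0
  then show ?case by (simp add: ideal_power_absorb)
next
  case (Suc m)
  from Suc.prems(1) show ?case
  proof (induction rule: ideal_power_Suc_induct)
    case zero
    then show ?case using self_module.subspace_0[OF subspace_ideal_power]
      by simp
  next
    case (add x y)
    then show ?case
      using self_module.subspace_add[OF subspace_ideal_power] by (simp add: distrib_right)
  next
    case (mult c x y)
    then have "x * (y * b) \<in> ideal_power J (Suc (m + k))"
      using Suc.IH Suc.prems(2) by (intro ideal_power_SucI)
    then have "c * (x * (y * b)) \<in> ideal_power J (Suc (m + k))" by (rule ideal_power_absorb)
    then show ?case by (simp only: add_Suc mult.assoc)
  qed
qed

lemma power_in_ideal_power: "a \<in> J \<Longrightarrow> a ^ m \<in> ideal_power J m"
proof (induction m)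
  case (Suc m)
  then show ?case unfolding power_Suc by (intro ideal_power_SucI)
qed simp

lemma prod_in_ideal_power:
  "(\<And>a. a \<in> A \<Longrightarrow> F a \<in> ideal_power J (e a)) \<Longrightarrow> (\<Prod>a\<in>A. F a) \<in> ideal_power J (\<Sum>a\<in>A. e a)"
proof (induction A rule: infinite_finite_induct)
  case (insert a A)
  then have "F a * (\<Prod>a\<in>A. F a) \<in> ideal_power J (e a + (\<Sum>a\<in>A. e a))"
    by (intro ideal_power_mult) auto
  then show ?case using insert by simp
qed simp_all

lemma ideal_power_antimono: "m \<le> k \<Longrightarrow> ideal_power J k \<subseteq> ideal_power J m"
proof (induction rule: dec_induct)
  case (step k)
  have "x \<in> ideal_power J k" if "x \<in> ideal_power J (Suc k)" for x
    using that
  proof (induction rule: ideal_power_Suc_induct)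
    case (mult c a b)
    then show ?case by (simp add: ideal_power_absorb)
  qed (use self_module.subspace_0[OF subspace_ideal_power]
      self_module.subspace_add[OF subspace_ideal_power] in auto)
  then show ?case using step by blast
qed simp

text \<open>
  Each of the \<open>m\<close> factors from \<open>J\<close> takes up one factor \<open>q\<close>.
\<close>

lemma power_mult_ideal_power:
  assumes "\<And>a. a \<in> J \<Longrightarrow> q * a \<in> I" and "f \<in> ideal_power J m"
  shows "q ^ m * f \<in> ideal_power I m"
  using assms(2)
proof (induction m arbitrary: f)
  case (Suc m)
  from Suc.prems show ?case
  proof (induction rule: ideal_power_Suc_induct)
    case zero
    then show ?case using self_module.subspace_0[OF subspace_ideal_power]
      by simp
  next
    case (add x y)
    then show ?case
      using self_module.subspace_add[OF subspace_ideal_power] by (simp only: distrib_left)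
  next
    case (mult c a b)
    then have "(q * a) * (q ^ m * b) \<in> ideal_power I (Suc m)"
      using Suc.IH assms(1) by (intro ideal_power_SucI)
    then have "c * ((q * a) * (q ^ m * b)) \<in> ideal_power I (Suc m)" by (rule ideal_power_absorb)
    then show ?case by (simp add: mult_ac)
  qed
qed simp

lemma prime_ideal_one_notin: "prime_ideal P \<Longrightarrow> 1 \<notin> P"
  unfolding prime_ideal_def using self_module.subspace_scale[of P 1] by auto

lemma prime_ideal_prod_notin:
  "prime_ideal P \<Longrightarrow> (\<And>a. a \<in> A \<Longrightarrow> F a \<notin> P) \<Longrightarrow> (\<Prod>a\<in>A. F a) \<notin> P"
  by (induction A rule: infinite_finite_induct)
    (auto simp: prime_ideal_one_notin, auto simp: prime_ideal_def)

lemma prime_ideal_power_notin: "prime_ideal P \<Longrightarrow> a \<notin> P \<Longrightarrow> a ^ m \<notin> P"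
  by (induction m) (auto simp: prime_ideal_one_notin, auto simp: prime_ideal_def)

text \<open>
  If \<open>P = (\<Inter>i. p i) : h\<close>, then \<open>P\<close> is the intersection of the \<open>p i\<close> that do not contain
  \<open>h\<close>. A prime ideal which is a finite intersection is one of its members: otherwise the product of
  elements of \<open>p i - P\<close> would lie in \<open>P\<close>.
\<close>

lemma associated_primes_Inter:
  assumes A: "finite A" and prime: "\<And>i. i \<in> A \<Longrightarrow> prime_ideal (p i)"
    and P: "P \<in> associated_primes (\<Inter>i\<in>A. p i)"
  shows "\<exists>i\<in>A. P = p i"
proof (rule ccontr)
  assume none: "\<not> ?thesis"
  obtain h where h: "P = {g. \<forall>i\<in>A. g * h \<in> p i}" and "prime_ideal P"
    using P by (auto simp: associated_primes_def)
  define B where "B = {i\<in>A. h \<notin> p i}"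
  have scale: "c * a \<in> p i" if "i \<in> A" "a \<in> p i" for i c a
    using prime[OF that(1)] that(2) self_module.subspace_scale by (auto simp: prime_ideal_def)
  have P_eq: "P = (\<Inter>i\<in>B. p i)"
  proof
    show "P \<subseteq> (\<Inter>i\<in>B. p i)" using prime by (auto simp: h B_def prime_ideal_def)
    show "(\<Inter>i\<in>B. p i) \<subseteq> P"
    proof
      fix x assume x: "x \<in> (\<Inter>i\<in>B. p i)"
      have "x * h \<in> p i" if "i \<in> A" for i
      proof (cases "h \<in> p i")
        case True
        then show ?thesis using scale that by blast
      next
        case False
        then have "h * x \<in> p i" using scale that x by (simp add: B_def)
        then show ?thesis by (simp add: mult.commute)
      qed
      then show "x \<in> P" by (simp add: h)
    qed
  qed
  have "\<forall>i\<in>B. \<exists>a. a \<in> p i \<and> a \<notin> P"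
  proof
    fix i assume "i \<in> B"
    then have "i \<in> A" "P \<subseteq> p i" using P_eq by (auto simp: B_def)
    then show "\<exists>a. a \<in> p i \<and> a \<notin> P" using none by blast
  qed
  then obtain a where a: "\<And>i. i \<in> B \<Longrightarrow> a i \<in> p i" "\<And>i. i \<in> B \<Longrightarrow> a i \<notin> P" by metis
  have "(\<Prod>i\<in>B. a i) \<notin> P" using prime_ideal_prod_notin[OF \<open>prime_ideal P\<close>] a by blast
  moreover have "(\<Prod>i\<in>B. a i) \<in> p i" if "i \<in> B" for i
  proof -
    have "finite B" using A by (simp add: B_def)
    then have "(\<Prod>i\<in>B. a i) = (\<Prod>j\<in>B - {i}. a j) * a i"
      using that by (simp add: prod.remove mult.commute)
    then show ?thesis using scale a that by (simp add: B_def)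
  qed
  ultimately show False using P_eq by blast
qed

text \<open>
  At the associated prime \<open>p i\<close>, choose elements of the other primes outside \<open>p i\<close>. Their product
  \<open>q\<close> carries \<open>p i\<close> into the intersection, so \<open>q\<^sup>m\<close> is a denominator for \<open>f\<close>.
\<close>

lemma symbolic_power_Inter_primes:
  assumes A: "finite A" and prime: "\<And>i. i \<in> A \<Longrightarrow> prime_ideal (p i)"
    and incomparable: "\<And>i j. i \<in> A \<Longrightarrow> j \<in> A \<Longrightarrow> i \<noteq> j \<Longrightarrow> \<not> p j \<subseteq> p i"
    and f: "\<And>i. i \<in> A \<Longrightarrow> f \<in> ideal_power (p i) m"
  shows "f \<in> symbolic_power (\<Inter>i\<in>A. p i) m"
  unfolding symbolic_power_def
proof (intro CollectI ballI)
  fix P assume "P \<in> associated_primes (\<Inter>i\<in>A. p i)"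
  then obtain i where i: "i \<in> A" "P = p i" using associated_primes_Inter[OF A, of p P] prime by blast
  have "\<forall>j\<in>A - {i}. \<exists>a. a \<in> p j \<and> a \<notin> p i"
    using incomparable i by blast
  then obtain a where a: "\<And>j. j \<in> A - {i} \<Longrightarrow> a j \<in> p j" "\<And>j. j \<in> A - {i} \<Longrightarrow> a j \<notin> p i"
    by metis
  have scale: "c * b \<in> p j" if "j \<in> A" "b \<in> p j" for j c b
    using prime[OF that(1)] that(2) self_module.subspace_scale by (auto simp: prime_ideal_def)
  define q where "q = (\<Prod>j\<in>A - {i}. a j)"
  have "q * b \<in> p j" if "j \<in> A" "b \<in> p i" for b j
  proof (cases "j = i")
    case True
    then show ?thesis using scale that by blast
  next
    case False
    then have "q * b = (b * (\<Prod>k\<in>A - {i} - {j}. a k)) * a j"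
      using A that unfolding q_def by (subst prod.remove[of _ j]) (auto simp: mult_ac)
    then show ?thesis using scale a that False by simp
  qed
  then have "q ^ m * f \<in> ideal_power (\<Inter>i\<in>A. p i) m"
    using f i by (intro power_mult_ideal_power[of "p i"]) auto
  moreover have "q ^ m \<notin> P"
    unfolding q_def i using a prime i by (intro prime_ideal_power_notin prime_ideal_prod_notin) auto
  ultimately show "\<exists>g. g \<notin> P \<and> g * f \<in> ideal_power (\<Inter>i\<in>A. p i) m" by blast
qed

text \<open>
  Denominators multiply, since their complement is prime.
\<close>

lemma symbolic_power_mult:
  assumes "f \<in> symbolic_power J m" "g \<in> symbolic_power J k"
  shows "f * g \<in> symbolic_power J (m + k)"
  unfolding symbolic_power_def
proof (intro CollectI ballI)
  fix P assume P: "P \<in> associated_primes J"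
  obtain a where a: "a \<notin> P" "a * f \<in> ideal_power J m"
    using assms(1) P by (auto simp: symbolic_power_def)
  obtain b where b: "b \<notin> P" "b * g \<in> ideal_power J k"
    using assms(2) P by (auto simp: symbolic_power_def)
  have "a * b \<notin> P" using P a b by (auto simp: associated_primes_def prime_ideal_def)
  moreover have "a * b * (f * g) \<in> ideal_power J (m + k)"
    using ideal_power_mult[OF a(2) b(2)] by (simp add: mult_ac)
  ultimately show "\<exists>h. h \<notin> P \<and> h * (f * g) \<in> ideal_power J (m + k)" by blast
qed

lemma ideal_power_subset_symbolic_power: "ideal_power J m \<subseteq> symbolic_power J m"
proof
  fix f assume "f \<in> ideal_power J m"
  then have "1 \<notin> P \<and> 1 * f \<in> ideal_power J m" if "P \<in> associated_primes J" for P
    using that by (simp add: associated_primes_def prime_ideal_one_notin)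
  then show "f \<in> symbolic_power J m"
    unfolding symbolic_power_def by blast
qed

text \<open>
  Fekete's lemma: the quotients of a subadditive sequence converge to their infimum. Writing
  \<open>k = q m + (k mod m)\<close> bounds \<open>a k\<close> by \<open>q a m\<close> plus a constant \<open>c\<close> that depends only on
  \<open>m\<close>.
\<close>

lemma subadditive_lim_le:
  fixes a :: "nat \<Rightarrow> nat"
  assumes subadd: "\<And>m k. a (m + k) \<le> a m + a k"
    and "m \<ge> 1"
  shows "lim (\<lambda>m. real (a m) / real m) \<le> real (a m) / real m"
proof -
  let ?b = "\<lambda>m. real (a m) / real m"
  define l where "l = (INF m\<in>{1..}. ?b m)"
  have bdd: "bdd_below (?b ` {1..})" by (rule bdd_belowI[of _ 0]) auto
  have l: "l \<le> ?b m" if "m \<ge> 1" for m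
    unfolding l_def using bdd that by (intro cINF_lower) auto
  have a_mult: "a (q * m) \<le> q * a m" if "q \<ge> 1" for q m
    using that
  proof (induction q rule: dec_induct)
    case (step q)
    then show ?case using subadd[of m "q * m"] by simp
  qed simp
  have "?b \<longlonglongrightarrow> l"
  proof (rule LIMSEQ_I)
    fix e :: real assume e: "e > 0"
    have "\<exists>m\<in>{1..}. ?b m < l + e / 2"
      unfolding l_def using bdd e by (subst cINF_less_iff[symmetric]) auto
    then obtain m where m: "m \<ge> 1" "?b m < l + e / 2" by auto
    define c where "c = (\<Sum>i<m. a i)"
    \<comment> \<open>large enough for \<open>k \<ge> m\<close> and \<open>c / k < e / 2\<close>\<close>
  define N where "N = Suc (m + nat \<lceil>2 * c / e\<rceil>)"
    have "norm (?b k - l) < e" if k: "k \<ge> N" for k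
    proof -
      have "m \<le> k" "k > 0" using k by (auto simp: N_def)
      then have "k div m \<ge> 1" using m by (simp add: div_greater_zero_iff Suc_le_eq)
      have "a k \<le> a (k div m * m) + a (k mod m)"
        using subadd[of "k div m * m" "k mod m"] by simp
      also have "\<dots> \<le> k div m * a m + c"
        unfolding c_def using m a_mult[OF \<open>k div m \<ge> 1\<close>]
        by (intro add_mono member_le_sum) auto
      finally have "real (a k) \<le> real (k div m) * real (a m) + real c"
        by (metis of_nat_add of_nat_le_iff of_nat_mult)
      moreover have "real (k div m) * real m \<le> real k"
        unfolding of_nat_mult[symmetric] of_nat_le_iff by simp
      then have "real (k div m) \<le> real k / real m" using m by (simp add: field_simps)
      then have "real (k div m) * real (a m) \<le> real k / real m * real (a m)"
        by (intro mult_right_mono) auto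
      ultimately have "real (a k) \<le> real k * ?b m + real c" by simp
      then have "real (a k) / real k \<le> (real k * ?b m + real c) / real k"
        by (intro divide_right_mono) auto
      then have "?b k \<le> ?b m + real c / real k"
        using \<open>k > 0\<close> by (simp add: add_divide_distrib)
      moreover have "real c / real k < e / 2"
      proof -
        have "2 * real c / e < real k" using k unfolding N_def by linarith
        then show ?thesis using e \<open>k > 0\<close> by (simp add: field_simps)
      qed
      ultimately have "?b k < l + e" using m(2) by linarith
      moreover have "l \<le> ?b k" using l \<open>k > 0\<close> by simp
      ultimately show ?thesis by simp
    qed
    then show "\<exists>N. \<forall>k\<ge>N. norm (?b k - l) < e" by blast
  qed
  then show ?thesis using l assms(2) by (simp add: limI)
qed

lemma initial_degree_le: "f \<in> J \<Longrightarrow> f \<noteq> 0 \<Longrightarrow> form d f \<Longrightarrow> initial_degree J \<le> d"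
  unfolding initial_degree_def by (intro Least_le) blast

text \<open>
  The initial degrees of the symbolic powers are subadditive, because the product of two nonzero
  forms is a nonzero form and symbolic powers multiply.
\<close>

lemma waldschmidt_constant_le:
  fixes J :: "('n::finite, 'k::idom) mpoly set"
  assumes inf: "infinite (UNIV :: 'k set)"
    and nonzero: "\<exists>f\<in>J. \<exists>d. f \<noteq> 0 \<and> form d f"
    and m: "m \<ge> 1"
  shows "waldschmidt_constant J \<le> real (initial_degree (symbolic_power J m)) / real m"
  unfolding waldschmidt_constant_def
proof (rule subadditive_lim_le[OF _ m])
  have attained: "\<exists>f\<in>symbolic_power J m. f \<noteq> 0 \<and> form (initial_degree (symbolic_power J m)) f" for m
  proof -
    obtain f d where f: "f \<in> J" "f \<noteq> 0" "form d f" using nonzero by blast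
    have "f ^ m \<noteq> 0"
      by (induction m) (use mpoly_mult_nonzero[OF inf f(2)] in auto)
    moreover have "f ^ m \<in> symbolic_power J m"
      using power_in_ideal_power f ideal_power_subset_symbolic_power by blast
    ultimately have "\<exists>d. \<exists>f\<in>symbolic_power J m. f \<noteq> 0 \<and> form d f" using form_power f by blast
    then show ?thesis unfolding initial_degree_def by (rule LeastI_ex)
  qed
  fix m k
  obtain f where f: "f \<in> symbolic_power J m" "f \<noteq> 0" "form (initial_degree (symbolic_power J m)) f"
    using attained by blast
  obtain g where g: "g \<in> symbolic_power J k" "g \<noteq> 0" "form (initial_degree (symbolic_power J k)) g"
    using attained by blast
  show "initial_degree (symbolic_power J (m + k))
      \<le> initial_degree (symbolic_power J m) + initial_degree (symbolic_power J k)"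
    using symbolic_power_mult[OF f(1) g(1)] mpoly_mult_nonzero[OF inf f(2) g(2)]
      form_mult[OF f(3) g(3)] by (rule initial_degree_le)
qed

section \<open>Counting exponent vectors\<close>

text \<open>
  Exponent vectors of the monomials of degree \<open>d\<close> in the variables \<open>A\<close>.
\<close>

definition compositions :: "'n set \<Rightarrow> nat \<Rightarrow> ('n::finite \<Rightarrow> nat) set" where
  "compositions A d = {v. (\<forall>i. i \<notin> A \<longrightarrow> v i = 0) \<and> (\<Sum>i\<in>A. v i) = d}"

lemma finite_compositions: "finite (compositions A d)"
proof (rule finite_subset)
  show "compositions A d \<subseteq> Pi\<^sub>E UNIV (\<lambda>_. {..d})"
  proof (intro subsetI PiE_I)
    fix v i assume v: "v \<in> compositions A d"
    show "v i \<in> {..d}"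
      using v member_le_sum[of i A v] by (cases "i \<in> A") (auto simp: compositions_def)
  qed simp
qed (intro finite_PiE, auto)

lemma card_compositions_split:
  fixes A B :: "'n::finite set"
  assumes "A \<inter> B = {}"
  shows "card {v \<in> compositions (A \<union> B) d. (\<Sum>i\<in>A. v i) = a} =
    (if a \<le> d then card (compositions A a) * card (compositions B (d - a)) else 0)"
proof (cases "a \<le> d")
  case True
  have split: "(\<Sum>i\<in>A \<union> B. v i) = (\<Sum>i\<in>A. v i) + (\<Sum>i\<in>B. v i)" for v :: "'n \<Rightarrow> nat"
    using assms by (simp add: sum.union_disjoint)
  have restrict: "(\<Sum>i\<in>C. if i \<in> C then v i else 0) = (\<Sum>i\<in>C. v i)" for C and v :: "'n \<Rightarrow> nat"
    by (intro sum.cong) auto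
  have other: "(\<Sum>i\<in>A. v i + w i) = a" "(\<Sum>i\<in>B. v i + w i) = d - a"
    if "v \<in> compositions A a" "w \<in> compositions B (d - a)" for v w
    using that assms by (auto simp: compositions_def sum.distrib disjoint_iff)
  have "bij_betw (\<lambda>(v, w) i. v i + w i) (compositions A a \<times> compositions B (d - a))
      {v \<in> compositions (A \<union> B) d. (\<Sum>i\<in>A. v i) = a}"
  proof (rule bij_betw_byWitness[where
        f' = "\<lambda>v. (\<lambda>i. if i \<in> A then v i else 0, \<lambda>i. if i \<in> B then v i else 0)"])
    show "\<forall>p\<in>compositions A a \<times> compositions B (d - a).
        (\<lambda>v. (\<lambda>i. if i \<in> A then v i else 0, \<lambda>i. if i \<in> B then v i else 0))
          ((\<lambda>(v, w) i. v i + w i) p) = p"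
      using assms by (auto simp: compositions_def fun_eq_iff disjoint_iff)
    show "\<forall>v\<in>{v \<in> compositions (A \<union> B) d. (\<Sum>i\<in>A. v i) = a}.
        (\<lambda>(v, w) i. v i + w i) ((\<lambda>i. if i \<in> A then v i else 0, \<lambda>i. if i \<in> B then v i else 0)) = v"
      using assms by (auto simp: compositions_def fun_eq_iff disjoint_iff)
    show "(\<lambda>(v, w) i. v i + w i) ` (compositions A a \<times> compositions B (d - a))
        \<subseteq> {v \<in> compositions (A \<union> B) d. (\<Sum>i\<in>A. v i) = a}"
    proof (clarify, intro CollectI conjI)
      fix v w assume vw: "v \<in> compositions A a" "w \<in> compositions B (d - a)"
      show "(\<lambda>i. v i + w i) \<in> compositions (A \<union> B) d"
        using vw other[OF vw] True by (auto simp: compositions_def split)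
      show "(\<Sum>i\<in>A. v i + w i) = a" using other[OF vw] by simp
    qed
    show "(\<lambda>v. (\<lambda>i. if i \<in> A then v i else 0, \<lambda>i. if i \<in> B then v i else 0)) `
        {v \<in> compositions (A \<union> B) d. (\<Sum>i\<in>A. v i) = a} \<subseteq> compositions A a \<times> compositions B (d - a)"
      by (auto simp: compositions_def split restrict)
  qed
  from bij_betw_same_card[OF this]
  have "card {v \<in> compositions (A \<union> B) d. (\<Sum>i\<in>A. v i) = a}
      = card (compositions A a \<times> compositions B (d - a))" by (rule sym)
  then show ?thesis using True by (simp add: card_cartesian_product)
next
  case False
  have "(\<Sum>i\<in>A. v i) \<le> d" if "v \<in> compositions (A \<union> B) d" for v
    using that sum_mono2[of "A \<union> B" A v] by (auto simp: compositions_def)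
  then have "{v \<in> compositions (A \<union> B) d. (\<Sum>i\<in>A. v i) = a} = {}" using False by auto
  then show ?thesis using False by (simp only: card.empty if_False)
qed

text \<open>
  Monomials of degree \<open>d\<close> whose degree in the variables \<open>A\<close> is less than \<open>m\<close>. When \<open>A\<close>
  consists of coordinates that cut out a linear subspace, these are the monomials that vanish on it
  to order less than \<open>m\<close>.
\<close>

lemma card_compositions_bounded:
  fixes A B :: "'n::finite set"
  assumes "A \<inter> B = {}" "m \<le> Suc d"
  shows "card {v \<in> compositions (A \<union> B) d. (\<Sum>i\<in>A. v i) < m} =
    (\<Sum>a<m. card (compositions A a) * card (compositions B (d - a)))"
proof -
  have "{v \<in> compositions (A \<union> B) d. (\<Sum>i\<in>A. v i) < m}
      = (\<Union>a<m. {v \<in> compositions (A \<union> B) d. (\<Sum>i\<in>A. v i) = a})" by auto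
  also have "card \<dots> = (\<Sum>a<m. card {v \<in> compositions (A \<union> B) d. (\<Sum>i\<in>A. v i) = a})"
    by (intro card_UN_disjoint) (auto simp: finite_compositions)
  also have "\<dots> = (\<Sum>a<m. card (compositions A a) * card (compositions B (d - a)))"
    using assms by (intro sum.cong) (auto simp: card_compositions_split)
  finally show ?thesis .
qed

lemma card_compositions:
  "card A = Suc k \<Longrightarrow> card (compositions A d) = (d + k) choose k"
proof (induction k arbitrary: A d)
  case 0
  then obtain a where A: "A = {a}" by (metis One_nat_def card_1_singletonE)
  have "compositions A d = {\<lambda>i. if i = a then d else 0}"
    by (auto simp: A compositions_def fun_eq_iff)
  then show ?case by simp
next
  case (Suc k)
  then obtain a B where A: "A = B \<union> {a}" "a \<notin> B" "card B = Suc k"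
    by (metis Un_insert_right card_Suc_eq sup_bot_right)
  have "card (compositions {a} e) = 1" for e
  proof -
    have "compositions {a} e = {\<lambda>i. if i = a then e else 0}"
      by (auto simp: compositions_def fun_eq_iff)
    then show ?thesis by simp
  qed
  moreover have "v \<in> compositions A d \<longleftrightarrow> v \<in> compositions A d \<and> (\<Sum>i\<in>B. v i) < Suc d" for v
    using A sum_mono2[of A B v] by (auto simp: compositions_def less_Suc_eq_le)
  then have "compositions A d = {v \<in> compositions (B \<union> {a}) d. (\<Sum>i\<in>B. v i) < Suc d}"
    using A by auto
  ultimately have "card (compositions A d) = (\<Sum>e<Suc d. (e + k) choose k)"
    using A card_compositions_bounded[of B "{a}" "Suc d" d] Suc.IH[OF A(3)] by simp
  also have "\<dots> = (\<Sum>e\<le>d. (k + e) choose k)" by (simp add: lessThan_Suc_atMost add.commute)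
  also have "\<dots> = (d + Suc k) choose Suc k"
    using choose_rising_sum(1)[of k d] by (simp add: add_ac)
  finally show ?case .
qed

lemma bij_lookup: "bij (Poly_Mapping.lookup :: ('n::finite \<Rightarrow>\<^sub>0 nat) \<Rightarrow> ('n \<Rightarrow> nat))"
  by (intro bijI injI poly_mapping_eqI surjI[of _ Abs_poly_mapping]) simp_all

lemma card_lookup: "card {u :: 'n::finite \<Rightarrow>\<^sub>0 nat. P (Poly_Mapping.lookup u)} = card {v. P v}"
    and finite_lookup: "finite {v. P v} \<Longrightarrow> finite {u :: 'n::finite \<Rightarrow>\<^sub>0 nat. P (Poly_Mapping.lookup u)}"
proof -
  have "bij_betw Poly_Mapping.lookup {u :: 'n \<Rightarrow>\<^sub>0 nat. P (Poly_Mapping.lookup u)} {v. P v}"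
    using bij_lookup by (auto simp: bij_betw_def inj_on_def surj_def image_iff) 
  then show "card {u :: 'n::finite \<Rightarrow>\<^sub>0 nat. P (Poly_Mapping.lookup u)} = card {v. P v}"
    "finite {v. P v} \<Longrightarrow> finite {u :: 'n::finite \<Rightarrow>\<^sub>0 nat. P (Poly_Mapping.lookup u)}"
    by (auto simp: bij_betw_same_card bij_betw_finite)
qed

section \<open>Linear algebra\<close>

text \<open>
  Gaussian elimination: an equation that involves the unknown \<open>u0\<close> is used to eliminate it from
  the others.
\<close>

lemma homogeneous_system_nontrivial:
  fixes c :: "'e \<Rightarrow> 'u \<Rightarrow> 'k::field"
  assumes "finite E" "finite K" "card E < card K"
  shows "\<exists>b. (\<exists>u\<in>K. b u \<noteq> 0) \<and> (\<forall>e\<in>E. (\<Sum>u\<in>K. b u * c e u) = 0)"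
  using assms
proof (induction E arbitrary: K c)
  case empty
  then have "K \<noteq> {}" by auto
  then show ?case by (intro exI[of _ "\<lambda>_. 1"]) auto
next
  case (insert e E)
  show ?case
  proof (cases "\<forall>u\<in>K. c e u = 0")
    case True
    have "card E < card K" using insert by simp
    then obtain b where "\<exists>u\<in>K. b u \<noteq> 0" "\<forall>e\<in>E. (\<Sum>u\<in>K. b u * c e u) = 0"
      using insert.IH insert.prems by blast
    then show ?thesis using True by (intro exI[of _ b]) auto
  next
    case False
    then obtain u0 where u0: "u0 \<in> K" "c e u0 \<noteq> 0" by blast
    let ?K = "K - {u0}"
    define c' where "c' e' u = c e' u - c e u / c e u0 * c e' u0" for e' u
    have "card E < card ?K" using insert u0 by simp
    then obtain b where b: "\<exists>u\<in>?K. b u \<noteq> 0" "\<forall>e'\<in>E. (\<Sum>u\<in>?K. b u * c' e' u) = 0"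
      using insert.IH[of ?K c'] insert.prems by blast
    \<comment> \<open>the value of the eliminated unknown is \<open>- s\<close>\<close>
    define s where "s = (\<Sum>u\<in>?K. b u * (c e u / c e u0))"
    define b' where "b' = b(u0 := - s)"
    have b'_sum: "(\<Sum>u\<in>K. b' u * c e' u) = (\<Sum>u\<in>?K. b u * c e' u) - s * c e' u0" for e'
    proof -
      have "(\<Sum>u\<in>?K. b' u * c e' u) = (\<Sum>u\<in>?K. b u * c e' u)"
        by (intro sum.cong) (auto simp: b'_def)
      then show ?thesis using u0 insert.prems by (simp add: sum.remove[of K u0] b'_def)
    qed
    have "(\<Sum>u\<in>K. b' u * c e u) = 0"
      unfolding b'_sum s_def sum_distrib_right sum_subtractf[symmetric]
      using u0 by (intro sum.neutral) auto
    moreover have "(\<Sum>u\<in>K. b' u * c e' u) = 0" if "e' \<in> E" for e'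
    proof -
      have "(\<Sum>u\<in>K. b' u * c e' u) = (\<Sum>u\<in>?K. b u * c' e' u)"
        unfolding b'_sum s_def sum_distrib_right sum_subtractf[symmetric]
        by (intro sum.cong) (auto simp: c'_def algebra_simps)
      then show ?thesis using b that by simp
    qed
    moreover have "\<exists>u\<in>K. b' u \<noteq> 0" using b by (auto simp: b'_def)
    ultimately show ?thesis by blast
  qed
qed

lemma card_add_card_Compl: "card J + card (- J) = CARD('n)" for J :: "'n::finite set"
  using card_Un_disjoint[of J "- J"] by (simp add: Compl_partition)

text \<open>
  The columns of \<open>A\<close> are a basis of the whole space that extends a basis of \<open>V\<close>, \<open>B\<close> computes
  coordinates with respect to it, and \<open>J\<close> collects the basis vectors that were added.
\<close>

lemma adapted_coordinates:
  fixes V :: "('k::field ^ 'n::finite) set"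
  assumes "vec.subspace V"
  obtains A B :: "'k ^ 'n ^ 'n" and J :: "'n set"
  where "A ** B = mat 1" "V = {x. \<forall>j\<in>J. (B *v x) $ j = 0}" "card J + vec.dim V = CARD('n)"
proof -
  obtain S where S: "S \<subseteq> V" "vec.independent S" "V \<subseteq> vec.span S" "card S = vec.dim V"
    using vec.basis_exists[of V] by blast
  have V_eq: "V = vec.span S" using S assms vec.span_minimal by blast
  define C where "C = vec.extend_basis S"
  have C: "S \<subseteq> C" "vec.independent C" "vec.span C = UNIV"
    using S by (simp_all add: C_def vec.extend_basis_superset vec.independent_extend_basis
        vec.span_extend_basis)
  have fin: "finite C" using C vec.independent_bound_general by blast
  have "card C = CARD('n)"
    using vec.dim_eq_card[OF _ C(2), of UNIV] C vec_dim_card[where 'a = 'k and 'n = 'n] by simp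
  then obtain \<beta> :: "'n \<Rightarrow> 'k ^ 'n" where \<beta>: "bij_betw \<beta> UNIV C"
    using finite_same_card_bij[of "UNIV :: 'n set" C] fin by auto
  define rep where "rep = vec.representation C"
  define B where "B = matrix (\<lambda>x. \<chi> j. rep x (\<beta> j))"
  define A :: "'k ^ 'n ^ 'n" where "A = (\<chi> i j. \<beta> j $ i)"
  define J where "J = {j. \<beta> j \<notin> S}"
  have B: "(B *v x) $ j = rep x (\<beta> j)" for x j
  proof -
    have "Vector_Spaces.linear (*s) (*s) (\<lambda>x. \<chi> j. rep x (\<beta> j))"
      by unfold_locales
        (use C in \<open>auto simp: rep_def vec_eq_iff vec.representation_add vec.representation_scale\<close>)
    then show ?thesis unfolding B_def by (simp add: matrix_works)
  qed
  have A: "(A *v y) $ i = (\<Sum>j\<in>UNIV. \<beta> j $ i * y $ j)" for y i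
    by (simp add: A_def matrix_vector_mult_def)
  have expand: "(\<Sum>j\<in>UNIV. rep x (\<beta> j) *s \<beta> j) = x" for x
  proof -
    have "(\<Sum>j\<in>UNIV. rep x (\<beta> j) *s \<beta> j) = (\<Sum>b\<in>C. rep x b *s b)"
      by (rule sum.reindex_bij_betw[OF \<beta>])
    also have "\<dots> = x"
      unfolding rep_def using C fin by (intro vec.sum_representation_eq) auto
    finally show ?thesis .
  qed
  have "A *v (B *v x) = x" for x
  proof -
    have "A *v (B *v x) = (\<Sum>j\<in>UNIV. rep x (\<beta> j) *s \<beta> j)"
      by (simp add: vec_eq_iff A B mult.commute)
    then show ?thesis using expand by simp
  qed
  then have "A ** B = mat 1" by (simp add: matrix_eq matrix_vector_mul_assoc[symmetric])
  moreover have "V = {x. \<forall>j\<in>J. (B *v x) $ j = 0}"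
  proof (intro equalityI subsetI CollectI ballI)
    fix x j assume x: "x \<in> V" and j: "j \<in> J"
    have "rep x = vec.representation S x"
      unfolding rep_def using x V_eq C by (intro vec.representation_extend) auto
    then show "(B *v x) $ j = 0"
      using j vec.representation_ne_zero[of S x "\<beta> j"] by (auto simp: B J_def)
  next
    fix x assume x: "x \<in> {x. \<forall>j\<in>J. (B *v x) $ j = 0}"
    have "rep x (\<beta> j) *s \<beta> j \<in> V" for j
    proof (cases "j \<in> J")
      case True
      then have "rep x (\<beta> j) = 0" using x by (auto simp: B[symmetric])
      then show ?thesis using vec.subspace_0[OF assms] by simp
    next
      case False
      then have "\<beta> j \<in> V" using S by (auto simp: J_def)
      then show ?thesis using vec.subspace_scale[OF assms] by blast
    qed
    then have "(\<Sum>j\<in>UNIV. rep x (\<beta> j) *s \<beta> j) \<in> V" by (intro vec.subspace_sum assms)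
    then show "x \<in> V" using expand by simp
  qed
  moreover have "card J + vec.dim V = CARD('n)"
  proof -
    have "bij_betw \<beta> (- J) S"
    proof -
      have "\<beta> ` (- J) = S" using C(1) \<beta> by (auto simp: J_def bij_betw_def)
      then show ?thesis using \<beta> by (auto simp: bij_betw_def inj_on_def)
    qed
    then have "card (- J) = vec.dim V" using S(4) bij_betw_same_card by metis
    then show ?thesis using card_add_card_Compl[of J] by simp
  qed
  ultimately show ?thesis using that by blast
qed

section \<open>Forms with prescribed vanishing order\<close>

definition linear_form :: "'k ^ 'n \<Rightarrow> ('n::finite, 'k::comm_ring_1) mpoly" where
  "linear_form a = (\<Sum>j\<in>UNIV. Poly_Mapping.single (Poly_Mapping.single j 1) (a $ j))"

lemma eval_mpoly_linear_form: "eval_mpoly (linear_form a) x = (\<Sum>j\<in>UNIV. a $ j * x $ j)"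
proof -
  have "(\<Prod>i\<in>UNIV. (x $ i) ^ Poly_Mapping.lookup (Poly_Mapping.single j (1::nat)) i) = x $ j" for j
  proof -
    have "(\<Prod>i\<in>UNIV. (x $ i) ^ Poly_Mapping.lookup (Poly_Mapping.single j (1::nat)) i)
        = (\<Prod>i\<in>UNIV. if i = j then x $ i else 1)"
      by (intro prod.cong) (auto simp: lookup_single)
    then show ?thesis by simp
  qed
  then show ?thesis by (simp add: linear_form_def eval_mpoly_sum eval_mpoly_single)
qed

lemma form_linear_form: "form 1 (linear_form a)"
  unfolding linear_form_def
  by (intro form_sum form_single) (simp add: lookup_single when_def)

definition linear_subst ::
    "'k ^ 'n ^ 'n \<Rightarrow> ('n::finite, 'k::comm_ring_1) mpoly \<Rightarrow> ('n, 'k) mpoly" where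
  "linear_subst A = eval_hom (Poly_Mapping.single 0) (\<lambda>i. linear_form (A $ i))"

lemma eval_mpoly_linear_subst: "eval_mpoly (linear_subst A f) y = eval_mpoly f (A *v y)"
  unfolding linear_subst_def eval_mpoly_eval_hom_single
  by (simp add: eval_mpoly_linear_form matrix_vector_mult_def)

lemma form_linear_subst:
  assumes "form d f"
  shows "form d (linear_subst A f)"
  unfolding linear_subst_def eval_hom_def
proof (rule form_sum)
  fix u assume "u \<in> Poly_Mapping.keys f"
  then have "(\<Sum>i\<in>UNIV. Poly_Mapping.lookup u i) = d" using assms by (simp add: form_def)
  moreover have "form (\<Sum>i\<in>UNIV. Poly_Mapping.lookup u i * 1)
      (\<Prod>i\<in>UNIV. linear_form (A $ i) ^ Poly_Mapping.lookup u i)"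
    by (intro form_prod form_power form_linear_form)
  ultimately have "form d (\<Prod>i\<in>UNIV. linear_form (A $ i) ^ Poly_Mapping.lookup u i)" by simp
  moreover have "form 0 (Poly_Mapping.single 0 (Poly_Mapping.lookup f u))"
    by (intro form_single) simp
  ultimately show "form d (Poly_Mapping.single 0 (Poly_Mapping.lookup f u)
      * (\<Prod>i\<in>UNIV. linear_form (A $ i) ^ Poly_Mapping.lookup u i))"
    using form_mult by fastforce
qed

lemma mpoly_eqI:
  fixes f g :: "('n::finite, 'k::idom) mpoly"
  assumes "infinite (UNIV :: 'k set)" "\<And>x. eval_mpoly f x = eval_mpoly g x"
  shows "f = g"
proof (rule ccontr)
  assume "f \<noteq> g"
  then obtain x where "eval_mpoly (f - g) x \<noteq> 0"
    using mpoly_nonzero_value[OF assms(1), of "f - g"] by auto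
  then show False using assms(2) by (simp add: eval_mpoly_diff)
qed

text \<open>
  In coordinates adapted to \<open>V\<close> every monomial of \<open>f\<close> has at least \<open>m\<close> factors among the
  linear forms that vanish on \<open>V\<close>. Rewriting \<open>f\<close> as the substitution of \<open>B\<close> into
  \<open>linear_subst A f\<close> displays it as a combination of such monomials.
\<close>

lemma ideal_power_vanishing_onI:
  fixes f :: "('n::finite, 'k::field) mpoly"
  assumes inf: "infinite (UNIV :: 'k set)"
    and AB: "A ** B = mat 1" and V: "V = {x. \<forall>j\<in>J. (B *v x) $ j = 0}"
    and order: "\<And>u. u \<in> Poly_Mapping.keys (linear_subst A f) \<Longrightarrow> m \<le> (\<Sum>j\<in>J. Poly_Mapping.lookup u j)"
  shows "f \<in> ideal_power (vanishing_on V) m"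
proof -
  let ?g = "linear_subst A f"
  have coord: "linear_form (B $ j) \<in> vanishing_on V" if "j \<in> J" for j
    using that by (auto simp: vanishing_on_def eval_mpoly_linear_form V matrix_vector_mult_def)
  have "Poly_Mapping.single 0 (Poly_Mapping.lookup ?g u)
      * (\<Prod>i\<in>UNIV. linear_form (B $ i) ^ Poly_Mapping.lookup u i) \<in> ideal_power (vanishing_on V) m"
    if u: "u \<in> Poly_Mapping.keys ?g" for u
  proof -
    have "(\<Prod>j\<in>J. linear_form (B $ j) ^ Poly_Mapping.lookup u j)
        \<in> ideal_power (vanishing_on V) (\<Sum>j\<in>J. Poly_Mapping.lookup u j)"
      by (intro prod_in_ideal_power power_in_ideal_power coord)
    then have "(\<Prod>j\<in>J. linear_form (B $ j) ^ Poly_Mapping.lookup u j) \<in> ideal_power (vanishing_on V) m"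
      using ideal_power_antimono[OF order[OF u]] by blast
    moreover have "(\<Prod>i\<in>UNIV. linear_form (B $ i) ^ Poly_Mapping.lookup u i)
        = (\<Prod>i\<in>UNIV - J. linear_form (B $ i) ^ Poly_Mapping.lookup u i)
          * (\<Prod>j\<in>J. linear_form (B $ j) ^ Poly_Mapping.lookup u j)"
      by (rule prod.subset_diff) auto
    ultimately show ?thesis by (simp add: ideal_power_absorb)
  qed
  then have "linear_subst B ?g \<in> ideal_power (vanishing_on V) m"
    unfolding linear_subst_def[of B] eval_hom_def
    by (intro self_module.subspace_sum subspace_ideal_power)
  moreover have "linear_subst B ?g = f"
    using AB by (intro mpoly_eqI[OF inf])
      (simp add: eval_mpoly_linear_subst matrix_vector_mul_assoc)
  ultimately show ?thesis by simp
qed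

lemma lookup_const_mult:
  fixes a :: "'k::comm_ring_1"
  shows "Poly_Mapping.lookup (Poly_Mapping.single 0 a * p) w = a * Poly_Mapping.lookup p w"
  unfolding mult_map_scale_conv_mult[symmetric] by (simp add: Poly_Mapping.map.rep_eq when_def)

text \<open>
  The forms of degree \<open>t\<close> have \<open>t + n\<close> over \<open>n\<close> coefficients. Membership in the \<open>m\<close>th power of
  the ideal of \<open>V i\<close> only requires that, in adapted coordinates, the coefficients at the monomials
  of transversal degree less than \<open>m\<close> vanish. These are linear conditions, and there are fewer of
  them than unknowns.
\<close>

lemma exists_form_in_ideal_powers:
  fixes V :: "nat \<Rightarrow> ('k::field ^ 'n::finite) set"
  assumes inf: "infinite (UNIV :: 'k set)" and n: "CARD('n) = n + 1" "r < n"
    and S: "finite S" and V: "\<And>i. i \<in> S \<Longrightarrow> vec.subspace (V i) \<and> vec.dim (V i) = r + 1"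
    and "m \<le> t"
    and count: "card S * (\<Sum>a<m. ((a + (n - r - 1)) choose (n - r - 1)) * ((t - a + r) choose r))
      < (t + n) choose n"
  shows "\<exists>f. f \<noteq> 0 \<and> form t f \<and> (\<forall>i\<in>S. f \<in> ideal_power (vanishing_on (V i)) m)"
proof -
  have "\<forall>i\<in>S. \<exists>(A :: 'k ^ 'n ^ 'n) (B :: 'k ^ 'n ^ 'n) J. A ** B = mat 1 \<and>
      V i = {x. \<forall>j\<in>J. (B *v x) $ j = 0} \<and> card J = n - r"
  proof
    fix i assume "i \<in> S"
    obtain A B :: "'k ^ 'n ^ 'n" and J :: "'n set" where "A ** B = mat 1"
      "V i = {x. \<forall>j\<in>J. (B *v x) $ j = 0}" "card J + vec.dim (V i) = CARD('n)"
      using adapted_coordinates[of "V i"] V[OF \<open>i \<in> S\<close>] by blast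
    moreover from this have "card J = n - r" using V[OF \<open>i \<in> S\<close>] n by simp
    ultimately show "\<exists>(A :: 'k ^ 'n ^ 'n) (B :: 'k ^ 'n ^ 'n) J. A ** B = mat 1 \<and>
      V i = {x. \<forall>j\<in>J. (B *v x) $ j = 0} \<and> card J = n - r" by blast
  qed
  from bchoice[OF this] obtain A :: "nat \<Rightarrow> 'k ^ 'n ^ 'n" where
    "\<forall>i\<in>S. \<exists>(B :: 'k ^ 'n ^ 'n) J. A i ** B = mat 1 \<and>
      V i = {x. \<forall>j\<in>J. (B *v x) $ j = 0} \<and> card J = n - r" ..
  from bchoice[OF this] obtain B :: "nat \<Rightarrow> 'k ^ 'n ^ 'n" where
    "\<forall>i\<in>S. \<exists>J. A i ** B i = mat 1 \<and>
      V i = {x. \<forall>j\<in>J. (B i *v x) $ j = 0} \<and> card J = n - r" ..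
  from bchoice[OF this] obtain J :: "nat \<Rightarrow> 'n set"
    where AB: "\<And>i. i \<in> S \<Longrightarrow> A i ** B i = mat 1"
      and VB: "\<And>i. i \<in> S \<Longrightarrow> V i = {x. \<forall>j\<in>J i. (B i *v x) $ j = 0}"
      and J: "\<And>i. i \<in> S \<Longrightarrow> card (J i) = n - r"
    by blast
  let ?l = "Poly_Mapping.lookup :: ('n \<Rightarrow>\<^sub>0 nat) \<Rightarrow> 'n \<Rightarrow> nat"
  define K where "K = {u. ?l u \<in> compositions UNIV t}"
  define low where "low i = {u. ?l u \<in> {v \<in> compositions UNIV t. (\<Sum>j\<in>J i. v j) < m}}" for i
  define E where "E = Sigma S low"
  define monomial where "monomial i u = (\<Prod>j\<in>UNIV. linear_form (A i $ j) ^ ?l u j)" for i u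
  have K: "finite K" "card K = (t + n) choose n"
    unfolding K_def using finite_lookup[of "\<lambda>v. v \<in> compositions (UNIV :: 'n set) t"]
      card_lookup[of "\<lambda>v. v \<in> compositions (UNIV :: 'n set) t"]
      card_compositions[of "UNIV :: 'n set" n t] n
    by (simp_all add: finite_compositions)
  have low: "finite (low i)"
    "card (low i) = (\<Sum>a<m. ((a + (n - r - 1)) choose (n - r - 1)) * ((t - a + r) choose r))"
    if i: "i \<in> S" for i
  proof -
    let ?P = "\<lambda>v. v \<in> {v \<in> compositions UNIV t. (\<Sum>j\<in>J i. v j) < m}"
    show "finite (low i)"
      unfolding low_def by (rule finite_lookup[of ?P]) (simp add: finite_compositions)
    have J1: "card (J i) = Suc (n - r - 1)" using J[OF i] n by simp
    have J2: "card (- J i) = Suc r"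
      using J[OF i] n card_add_card_Compl[of "J i"] by simp
    have "card (low i) = card {v \<in> compositions (J i \<union> - J i) t. (\<Sum>j\<in>J i. v j) < m}"
      unfolding low_def using card_lookup[of ?P] by simp
    also have "\<dots> = (\<Sum>a<m. card (compositions (J i) a) * card (compositions (- J i) (t - a)))"
      using \<open>m \<le> t\<close> by (intro card_compositions_bounded) auto
    finally show "card (low i)
        = (\<Sum>a<m. ((a + (n - r - 1)) choose (n - r - 1)) * ((t - a + r) choose r))"
      by (simp only: card_compositions[OF J1] card_compositions[OF J2])
  qed
  have "finite E" unfolding E_def using S low by blast
  moreover have "card E < card K"
    unfolding E_def K(2) using S low count by (simp add: card_SigmaI)
  ultimately obtain b where b: "\<exists>u\<in>K. b u \<noteq> 0"
    "\<forall>e\<in>E. (\<Sum>u\<in>K. b u * (case e of (i, w) \<Rightarrow> Poly_Mapping.lookup (monomial i u) w)) = 0"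
    using homogeneous_system_nontrivial[of E K
        "\<lambda>e u. case e of (i, w) \<Rightarrow> Poly_Mapping.lookup (monomial i u) w"] K by blast
  define f where "f = (\<Sum>u\<in>K. Poly_Mapping.single u (b u))"
  have form: "form t f"
    unfolding f_def by (intro form_sum form_single) (simp add: K_def compositions_def)
  have subst: "linear_subst (A i) f = (\<Sum>u\<in>K. Poly_Mapping.single 0 (b u) * monomial i u)" for i
    unfolding f_def linear_subst_def monomial_def coeff_hom.eval_hom_sum[OF coeff_hom_single]
      coeff_hom.eval_hom_single[OF coeff_hom_single] ..
  have "f \<in> ideal_power (vanishing_on (V i)) m" if i: "i \<in> S" for i
  proof (rule ideal_power_vanishing_onI[OF inf AB[OF i] VB[OF i]])
    fix w assume w: "w \<in> Poly_Mapping.keys (linear_subst (A i) f)"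
    show "m \<le> (\<Sum>j\<in>J i. ?l w j)"
    proof (rule ccontr)
      assume "\<not> ?thesis"
      moreover have "(\<Sum>j\<in>UNIV. ?l w j) = t"
        using form_linear_subst[OF form] w by (auto simp: form_def)
      ultimately have "(i, w) \<in> E" using i by (simp add: E_def low_def compositions_def)
      then have "Poly_Mapping.lookup (linear_subst (A i) f) w = 0"
        using b(2) by (auto simp: subst lookup_sum lookup_const_mult)
      then show False using w by (simp add: in_keys_iff)
    qed
  qed
  moreover have "f \<noteq> 0"
  proof -
    obtain u0 where u0: "u0 \<in> K" "b u0 \<noteq> 0" using b(1) by blast
    have "Poly_Mapping.lookup f u0 = (\<Sum>u\<in>K. if u = u0 then b u else 0)"
      unfolding f_def lookup_sum by (intro sum.cong) (auto simp: lookup_single when_def)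
    also have "\<dots> = b u0" using u0 K by (simp add: sum.delta)
    finally show ?thesis using u0 by auto
  qed
  ultimately show ?thesis using form by blast
qed

lemma separating_linear_form:
  fixes V :: "('k::field ^ 'n::finite) set"
  assumes "vec.subspace V" "x \<notin> V"
  shows "\<exists>a. linear_form a \<in> vanishing_on V \<and> eval_mpoly (linear_form a) x \<noteq> 0"
proof -
  obtain A B :: "'k ^ 'n ^ 'n" and J :: "'n set" where "A ** B = mat 1"
    and V: "V = {x. \<forall>j\<in>J. (B *v x) $ j = 0}"
    by (rule adapted_coordinates[OF assms(1)])
  have eval: "eval_mpoly (linear_form (B $ j)) y = (B *v y) $ j" for j y
    by (simp add: eval_mpoly_linear_form matrix_vector_mult_def)
  obtain j where j: "j \<in> J" "(B *v x) $ j \<noteq> 0" using assms(2) V by blast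
  have "linear_form (B $ j) \<in> vanishing_on V" using j(1) eval V by (simp add: vanishing_on_def)
  moreover have "eval_mpoly (linear_form (B $ j)) x \<noteq> 0" using j(2) eval by simp
  ultimately show ?thesis by blast
qed

text \<open>
  For \<open>m \<le> t\<close> every binomial polynomial is evaluated at a natural number, so the expected
  polynomial takes the value of the dimension count above.
\<close>

lemma expected_poly_pos_iff:
  assumes "m \<le> t"
  shows "poly (expected_poly n r s m) (of_nat t) > 0 \<longleftrightarrow>
    s * (\<Sum>a<m. ((a + (n - r - 1)) choose (n - r - 1)) * ((t - a + r) choose r)) < (t + n) choose n"
proof -
  let ?c = "\<Sum>a<m. ((a + (n - r - 1)) choose (n - r - 1)) * ((t - a + r) choose r)"
  have "poly (conditions_poly n r m) (of_nat t) = (of_nat ?c :: rat)"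
    unfolding conditions_poly_def poly_sum of_nat_sum
  proof (intro sum.cong refl)
    fix a assume "a \<in> {..<m}"
    then have "a \<le> t" using assms by simp
    then have "(of_nat t - of_nat a + of_nat r gchoose r) = (of_nat ((t - a + r) choose r) :: rat)"
      by (simp only: of_nat_add_choose of_nat_diff)
    then show "poly (smult (of_nat ((a + (n - r - 1)) choose (n - r - 1)))
          (pcompose (binomial_poly r) [:- of_nat a, 1:])) (of_nat t)
        = (of_nat (((a + (n - r - 1)) choose (n - r - 1)) * ((t - a + r) choose r)) :: rat)"
      by (simp add: poly_pcompose poly_binomial_poly)
  qed
  moreover have "poly (binomial_poly n) (of_nat t) = (of_nat ((t + n) choose n) :: rat)"
    unfolding poly_binomial_poly of_nat_add_choose ..
  ultimately have "poly (expected_poly n r s m) (of_nat t)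
      = of_nat ((t + n) choose n) - (of_nat (s * ?c) :: rat)"
    unfolding expected_poly_def poly_diff poly_smult by (simp only: of_nat_mult)
  then show ?thesis by (simp only: diff_gt_0_iff_gt of_nat_less_iff)
qed

theorem theorem2p4:
  fixes n r s :: nat
    and L :: "nat \<Rightarrow> ('k::alg_closed_field ^ 'n::finite) set set"
    and I :: "('n, 'k) mpoly set"
  assumes "CARD('n) = n + 1"
    and "n \<ge> 2 * r + 1"
    and "s \<ge> 1"
    and "\<And>i. i \<in> {1..s} \<Longrightarrow> projective_linear_subspace r (L i)"
    and "\<And>i j. i \<in> {1..s} \<Longrightarrow> j \<in> {1..s} \<Longrightarrow> i \<noteq> j \<Longrightarrow> L i \<inter> L j = {}"
    and "I = (\<Inter>i\<in>{1..s}. vanishing_ideal (L i))"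
  shows "(\<exists>!\<tau>. \<tau> \<ge> 1 \<and> \<tau> \<in> Lambda_roots n r s) \<and>
    (\<forall>g. g \<ge> 1 \<and> g \<in> Lambda_roots n r s \<longrightarrow>
       waldschmidt_constant I \<le> expected_waldschmidt n r s \<and> expected_waldschmidt n r s \<le> g)"
proof -
  note inf = infinite_UNIV_alg_closed[where 'k = 'k]
  have "r < n" using assms(2) by simp
  obtain V where V: "\<And>i. i \<in> {1..s} \<Longrightarrow> vec.subspace (V i) \<and> vec.dim (V i) = r + 1 \<and>
      L i = {p \<in> projective_points. p \<subseteq> V i}"
    using assms(4) unfolding projective_linear_subspace_def by metis
  have nontrivial: "V i \<noteq> {0}" and proper: "V i \<noteq> UNIV" if "i \<in> {1..s}" for i
    using V[OF that] assms(1) \<open>r < n\<close> vec_dim_card[where 'a = 'k and 'n = 'n] by auto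
  have I: "I = (\<Inter>i\<in>{1..s}. vanishing_on (V i))"
    unfolding assms(6) using V nontrivial by (intro INF_cong) (auto simp: vanishing_ideal_eq[OF inf])
  have incomparable: "\<not> vanishing_on (V j) \<subseteq> vanishing_on (V i)"
    if ij: "i \<in> {1..s}" "j \<in> {1..s}" "i \<noteq> j" for i j
  proof -
    obtain x where x: "x \<in> V i" "x \<noteq> 0"
      using nontrivial[OF ij(1)] V[OF ij(1)] vec.subspace_0 by blast
    have "x \<notin> V j"
    proof
      assume "x \<in> V j"
      then have "vec.span {x} \<in> L i \<inter> L j"
        using x V ij by (simp add: projective_point_span vec.span_minimal)
      then show False using assms(5) ij by blast
    qed
    then show ?thesis
      using separating_linear_form[of "V j" x] V[OF ij(2)] x by (auto simp: vanishing_on_def)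
  qed
  have "\<exists>h. linear_form h \<in> vanishing_on (V i) \<and> linear_form h \<noteq> 0" if i: "i \<in> {1..s}" for i
  proof -
    obtain x where "x \<notin> V i" using proper[OF i] by blast
    then show ?thesis
      using separating_linear_form[of "V i" x] V[OF i] by (metis eval_mpoly_zero)
  qed
  then obtain h where h: "\<And>i. i \<in> {1..s} \<Longrightarrow> linear_form (h i) \<in> vanishing_on (V i)"
    "\<And>i. i \<in> {1..s} \<Longrightarrow> linear_form (h i) \<noteq> 0" by metis
  \<comment> \<open>a form in \<open>I\<close>: one hyperplane through each of the subspaces\<close>
  define F where "F = (\<Prod>i\<in>{1..s}. linear_form (h i))"
  have "F \<in> I"
    unfolding I F_def vanishing_on_def
  proof (intro INT_I CollectI ballI)
    fix i x assume i: "i \<in> {1..s}" and "x \<in> V i"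
    then have "eval_mpoly (linear_form (h i)) x = 0" using h(1) unfolding vanishing_on_def by blast
    then show "eval_mpoly (\<Prod>i\<in>{1..s}. linear_form (h i)) x = 0"
      unfolding eval_mpoly_prod by (intro prod_zero bexI[of _ i] i) auto
  qed
  moreover have "F \<noteq> 0"
  proof -
    have "finite A \<Longrightarrow> A \<subseteq> {1..s} \<Longrightarrow> (\<Prod>i\<in>A. linear_form (h i)) \<noteq> 0" for A
      by (induction A rule: finite_induct) (use mpoly_mult_nonzero[OF inf] h in auto)
    then show ?thesis by (simp add: F_def)
  qed
  moreover have "form (\<Sum>i\<in>{1..s}. 1) F" unfolding F_def by (intro form_prod form_linear_form)
  ultimately have form_in_I: "\<exists>f\<in>I. \<exists>d. f \<noteq> 0 \<and> form d f" by blast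
  have ratio: "waldschmidt_constant I \<le> real t / real m"
    if "t \<ge> m" "m \<ge> 1" "poly (expected_poly n r s m) (of_nat t) > 0" for t m
  proof -
    have "\<exists>f. f \<noteq> 0 \<and> form t f \<and> (\<forall>i\<in>{1..s}. f \<in> ideal_power (vanishing_on (V i)) m)"
    proof (rule exists_form_in_ideal_powers[OF inf assms(1) \<open>r < n\<close>])
      show "vec.subspace (V i) \<and> vec.dim (V i) = r + 1" if "i \<in> {1..s}" for i
        using V[OF that] by blast
      show "card {1..s} * (\<Sum>a<m. ((a + (n - r - 1)) choose (n - r - 1)) * ((t - a + r) choose r))
          < (t + n) choose n"
        using that(3) expected_poly_pos_iff[OF that(1)] by simp
    qed (use that in auto)
    then obtain f where f: "f \<noteq> 0" "form t f" "\<forall>i\<in>{1..s}. f \<in> ideal_power (vanishing_on (V i)) m"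
      by blast
    have "f \<in> symbolic_power I m"
      unfolding I using V f(3) incomparable
      by (intro symbolic_power_Inter_primes) (auto intro: prime_vanishing_on[OF inf])
    then have "initial_degree (symbolic_power I m) \<le> t" using f initial_degree_le by blast
    then have "real (initial_degree (symbolic_power I m)) / real m \<le> real t / real m"
      by (simp add: divide_right_mono)
    then show ?thesis using waldschmidt_constant_le[OF inf form_in_I that(2)] by linarith
  qed
  show ?thesis
  proof (intro conjI allI impI)
    show "\<exists>!\<tau>. \<tau> \<ge> 1 \<and> \<tau> \<in> Lambda_roots n r s"
      using Lambda_unique_root \<open>r < n\<close> assms(3) .
    fix g assume g: "1 \<le> g \<and> g \<in> Lambda_roots n r s"
    show "expected_waldschmidt n r s \<le> g"
      using expected_waldschmidt_le_root \<open>r < n\<close> assms(3) g by blast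
    show "waldschmidt_constant I \<le> expected_waldschmidt n r s"
      unfolding expected_waldschmidt_def
    proof (rule cInf_greatest)
      show "{real t / real m |t m. t \<ge> m \<and> m \<ge> 1 \<and> poly (expected_poly n r s m) (of_nat t) > 0} \<noteq> {}"
        using expected_ratio_below[of r n s g "g + 1"] \<open>r < n\<close> assms(3) g by auto
    qed (use ratio in auto)
  qed
qed

end
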